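(* Let $n$ be a positive integer and let $w\in S_n$ be a $321$-avoiding permutation, with associated flagging $f(w)=(f_1,\dots,f_r)$ and associated skew partition $\sigma(w)=\lambda/\mu$. Then the double Grothendieck polynomial $\mathfrak{G}_w(x,b)$ satisfies \[ \mathfrak{G}_{w}(x,b) = \sum_{T\in SVT(\sigma(w),f(w))} \beta^{|T|-|\sigma(w)|} \prod_{e\in T} \left(x_{val(e)} \oplus b_{\lambda_{r(e)} + f_{r(e)} - c(e) - val(e) +1}\right). \]
   Context: Notation: $x=(x_1,\dots,x_n)$ and $b=(b_1,\dots,b_n)$ are two sets of variables, $\beta$ is a formal variable, and all polynomials lie in $\mathbb{Z}[\beta][x,b]$. For $u,v$ put $u\oplus v:=u+v+\beta uv$. Double Grothendieck polynomials: $S_n$ is the group of permutations of $\{1,\dots,n\}$, with $s_i=(i,i+1)$ for $1\le i\le n-1$; products are compositions, so $(ws_i)(j)=w(s_i(j))$. $\ell(w)$ is the Coxeter length. $S_n$ acts on $\mathbb{Z}[\beta][x,b]$ by permuting the indices of the $x$-variables (fixing the $b$-variables). The divided difference operator is \[ \pi_i(g)=\frac{(1+\beta x_{i+1})g-(1+\beta x_i)\,s_i g}{x_i-x_{i+1}}. \] For the longest element $w_0\in S_n$ put $\mathfrak{G}_{w_0}=\prod_{i+j\le n}(x_i\oplus b_j)$ (product over positive integers $i,j$). For $w\neq w_0$ choose $i$ with $\ell(ws_i)=\ell(w)+1$ and set $\mathfrak{G}_w:=\pi_i(\mathfrak{G}_{ws_i})$; this is independent of the choice, since the $\pi_i$ satisfy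 the braid and commutation relations. $321$-avoiding permutations: $w\in S_n$ is $321$-avoiding if there are no $i<j<k$ with $w(i)>w(j)>w(k)$. For such $w$, let $f(w)=(f_1,\dots,f_r)$ be the increasing sequence of all indices $i$ with $w(i)>i$ (then $w(f_1)<\cdots<w(f_r)$). Define, for $i=1,\dots,r$, \[ \lambda_i=w(f_r)-r-(f_i-i),\qquad \mu_i=w(f_r)-r-(w(f_i)-i), \] and $\sigma(w)=\lambda/\mu$. (If $w$ is the identity then $r=0$, $\sigma(w)$ is the empty shape, and there is a single, empty, tableau.) Tableaux: for partitions $\lambda=(\lambda_1\ge\cdots\ge\lambda_r>0)$ and $\mu=(\mu_1\ge\cdots\ge\mu_r\ge0)$ with $\mu_i\le\lambda_i$, the skew partition $\lambda/\mu$ is identified with the set of boxes $\{(i,j): 1\le i\le r,\ \mu_i<j\le\lambda_i\}$ ($i$ is the row index, increasing from top to bottom, and $j$ the column index, increasing from left to right); $|\lambda/\mu|$ is the number of boxes. For nonempty finite sets $A,B$ of positive integers write $A<B$ if $\max A<\min B$ and $A\le B$ if $\max A\le\min B$. A set-valued tableau of shape $\lambda/\mu$ assigns to each box a nonempty finite set of positive integers so that rows are weakly increasing ($\le$) from left to right and columns are strictly increasing ($<$) from top to bottom. For a flagging $f=(f_1\le\cdots\le f_r)$ of positive integers, $SVT(\lambda/\mu,f)$ is the set of set-valued tableaux of shape $\lambda/\mu$ such that each set in row $i$ is a subset of $\{1,\dots,f_i\}$, for all $i$. An entry $e\in T$ is an element of the set assigned to one of the boxes; $val(e)$ is its value, and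 $r(e)$, $c(e)$ are the row and column indices of its box. $|T|$ is the total number of entries of $T$. *)

theory Defs
  imports
    "HOL-Library.Poly_Mapping"
    "HOL-Library.FuncSet"
    "HOL-Computational_Algebra.Polynomial"
    "HOL-Combinatorics.Permutations"
begin

section \<open>The polynomial ring\<close>

text \<open>
  Polynomials over \<open>\<int>[\<beta>]\<close>, represented as \<open>int poly\<close>, in variables \<open>x\<^sub>i\<close>, \<open>b\<^sub>j\<close> indexed by
  all natural numbers; for each \<open>n\<close> this ring contains
  \<open>\<int>[\<beta>][x\<^sub>1, \<dots>, x\<^sub>n, b\<^sub>1, \<dots>, b\<^sub>n]\<close> as a subring.
\<close>

datatype indet = X nat | B nat

type_synonym pol = "(indet \<Rightarrow>\<^sub>0 nat) \<Rightarrow>\<^sub>0 int poly"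

definition variable :: "indet \<Rightarrow> pol" where
  "variable v = Poly_Mapping.single (Poly_Mapping.single v 1) 1"

abbreviation xvar :: "nat \<Rightarrow> pol" where "xvar i \<equiv> variable (X i)"

abbreviation bvar :: "nat \<Rightarrow> pol" where "bvar i \<equiv> variable (B i)"

definition \<beta> :: pol where
  "\<beta> = Poly_Mapping.single 0 [:0, 1:]"

definition oplus :: "pol \<Rightarrow> pol \<Rightarrow> pol" (infixl "\<oplus>" 65) where
  "u \<oplus> v = u + v + \<beta> * u * v"

fun rename_x :: "(nat \<Rightarrow> nat) \<Rightarrow> indet \<Rightarrow> indet" where
  "rename_x s (X i) = X (s i)"
| "rename_x s (B i) = B i"

text \<open>
  The action of a permutation \<open>s\<close> on the indices of the \<open>x\<close>-variables.  Reindexing the keys is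
  contravariant, so doing it for exponents and then for monomials sends \<open>xvar i\<close> to \<open>xvar (s i)\<close>;
  see the lemmas below.
\<close>

definition permute_x :: "(nat \<Rightarrow> nat) \<Rightarrow> pol \<Rightarrow> pol" where
  "permute_x s g = Poly_Mapping.map_key (Poly_Mapping.map_key (rename_x s)) g"

lemma inj_rename_x:
  assumes "bij s"
  shows "inj (rename_x s)"
proof (rule injI)
  fix u v assume "rename_x s u = rename_x s v"
  then show "u = v"
    using bij_is_inj[OF assms] by (cases u; cases v) (simp_all add: inj_eq)
qed

lemma rename_x_inverse:
  assumes "bij s"
  shows "rename_x (inv s) \<circ> rename_x s = id" "rename_x s \<circ> rename_x (inv s) = id"
proof -
  have "rename_x (inv s) (rename_x s v) = v" "rename_x s (rename_x (inv s) v) = v" for v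
    using assms by (cases v; simp add: bij_is_inj bij_is_surj surj_f_inv_f)+
  then show "rename_x (inv s) \<circ> rename_x s = id" "rename_x s \<circ> rename_x (inv s) = id"
    by (auto simp: fun_eq_iff)
qed

lemma map_key_rename_x_inverse:
  assumes "bij s"
  shows "Poly_Mapping.map_key (rename_x s) (Poly_Mapping.map_key (rename_x (inv s)) m) = m"
    and "Poly_Mapping.map_key (rename_x (inv s)) (Poly_Mapping.map_key (rename_x s) m) = m"
  using inj_rename_x[OF assms] inj_rename_x[OF bij_imp_bij_inv[OF assms]] rename_x_inverse[OF assms]
  by (simp_all add: map_key_compose id_def map_key_id)

lemma inj_map_key_rename_x:
  assumes "bij s"
  shows "inj (Poly_Mapping.map_key (rename_x s) :: (indet \<Rightarrow>\<^sub>0 nat) \<Rightarrow> _)"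
  by (rule inj_on_inverseI[where g = "Poly_Mapping.map_key (rename_x (inv s))"])
     (simp add: map_key_rename_x_inverse[OF assms])

lemma permute_x_single:
  assumes "bij s"
  shows "permute_x s (Poly_Mapping.single m c)
       = Poly_Mapping.single (Poly_Mapping.map_key (rename_x (inv s)) m) c"
  using map_key_single[OF inj_map_key_rename_x[OF assms],
      where k = "Poly_Mapping.map_key (rename_x (inv s)) m" and v = c]
  by (simp add: permute_x_def map_key_rename_x_inverse[OF assms])

lemma permute_x_variable:
  assumes "bij s"
  shows "permute_x s (variable v) = variable (rename_x s v)"
proof -
  have "v = rename_x (inv s) (rename_x s v)"
    using rename_x_inverse(1)[OF assms] by (simp add: fun_eq_iff)
  then have "Poly_Mapping.map_key (rename_x (inv s)) (Poly_Mapping.single v (1::nat))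
      = Poly_Mapping.single (rename_x s v) 1"
    by (metis map_key_single[OF inj_rename_x[OF bij_imp_bij_inv[OF assms]]])
  then show ?thesis
    by (simp add: variable_def permute_x_single[OF assms])
qed

lemma permute_x_const:
  assumes "bij s"
  shows "permute_x s (Poly_Mapping.single 0 c) = Poly_Mapping.single 0 c"
  by (simp add: permute_x_single[OF assms] map_key_zero inj_rename_x bij_imp_bij_inv assms)

lemma permute_x_add:
  assumes "bij s"
  shows "permute_x s (g + h) = permute_x s g + permute_x s h"
  by (simp add: permute_x_def map_key_plus inj_map_key_rename_x[OF assms])

lemma poly_mapping_single_induct [case_names zero add]:
  fixes p :: "'a \<Rightarrow>\<^sub>0 'b::comm_monoid_add"
  assumes zero: "P 0" and add: "\<And>k c p. P p \<Longrightarrow> P (Poly_Mapping.single k c + p)"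
  shows "P p"
proof (induction p rule: Poly_Mapping.update_induct)
  case const
  show ?case by (rule zero)
next
  case (update f k c)
  have "Poly_Mapping.update k c f = Poly_Mapping.single k c + f"
    using update(1)
    by (intro poly_mapping_eqI) (auto simp: lookup_update lookup_add lookup_single in_keys_iff when_def)
  then show ?case using add[OF update(3)] by simp
qed

lemma permute_x_mult:
  assumes "bij s"
  shows "permute_x s (g * h) = permute_x s g * permute_x s h"
proof -
  have inj: "inj (rename_x (inv s))"
    by (rule inj_rename_x[OF bij_imp_bij_inv[OF assms]])
  have zero_eq: "permute_x s 0 = 0"
    using permute_x_const[OF assms, of 0] by simp
  have single: "permute_x s (Poly_Mapping.single k c * h)
      = permute_x s (Poly_Mapping.single k c) * permute_x s h" for k c
  proof (induction h rule: poly_mapping_single_induct)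
    case zero
    show ?case by (simp add: zero_eq)
  next
    case (add l d h)
    then show ?case
      by (simp add: distrib_left permute_x_add[OF assms] mult_single permute_x_single[OF assms]
          map_key_plus[OF inj])
  qed
  show ?thesis
  proof (induction g rule: poly_mapping_single_induct)
    case zero
    show ?case by (simp add: zero_eq)
  next
    case (add l d g)
    then show ?case
      by (simp add: distrib_right permute_x_add[OF assms] single)
  qed
qed

section \<open>Double Grothendieck polynomials\<close>

definition sim :: "nat \<Rightarrow> nat \<Rightarrow> nat" where
  "sim i = transpose i (i + 1)"

text \<open>Elements of \<open>S\<^sub>n\<close> are functions \<open>w\<close> with \<open>w permutes {1..n}\<close>.\<close>

definition coxeter_length :: "nat \<Rightarrow> (nat \<Rightarrow> nat) \<Rightarrow> nat" where
  "coxeter_length n w =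
     (LEAST k. \<exists>is. length is = k \<and> set is \<subseteq> {1..<n} \<and> w = foldr (\<lambda>i u. sim i \<circ> u) is id)"

definition longest :: "nat \<Rightarrow> nat \<Rightarrow> nat" where
  "longest n = (ARG_MAX (coxeter_length n) w. w permutes {1..n})"

text \<open>
  The divided difference operator; the quotient is the unique polynomial \<open>q\<close> below, as \<open>pol\<close>
  is an integral domain and the numerator vanishes at \<open>x\<^sub>i = x\<^sub>i\<^sub>+\<^sub>1\<close>.
\<close>

definition divided_difference :: "nat \<Rightarrow> pol \<Rightarrow> pol" where
  "divided_difference i g =
     (THE q. (xvar i - xvar (i + 1)) * q
           = (1 + \<beta> * xvar (i + 1)) * g - (1 + \<beta> * xvar i) * permute_x (sim i) g)"

definition grothendieck_longest :: "nat \<Rightarrow> pol" where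
  "grothendieck_longest n = (\<Prod>(i, j) \<in> {(i, j). 1 \<le> i \<and> 1 \<le> j \<and> i + j \<le> n}. xvar i \<oplus> bvar j)"

text \<open>
  All polynomials obtained for \<open>w\<close> by some sequence of choices of \<open>i\<close>; as this is independent
  of the choices, there is exactly one of them for every \<open>w\<close>.
\<close>

inductive is_grothendieck :: "nat \<Rightarrow> (nat \<Rightarrow> nat) \<Rightarrow> pol \<Rightarrow> bool" for n :: nat where
  longest: "is_grothendieck n (longest n) (grothendieck_longest n)"
| step: "is_grothendieck n w (divided_difference i g)"
    if "w permutes {1..n}" "w \<noteq> longest n" "i \<in> {1..<n}"
       "coxeter_length n (w \<circ> sim i) = coxeter_length n w + 1"
       "is_grothendieck n (w \<circ> sim i) g"

definition grothendieck :: "nat \<Rightarrow> (nat \<Rightarrow> nat) \<Rightarrow> pol" where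
  "grothendieck n w = (THE g. is_grothendieck n w g)"

section \<open>The flagging and the skew shape of a 321-avoiding permutation\<close>

definition avoids_321 :: "nat \<Rightarrow> (nat \<Rightarrow> nat) \<Rightarrow> bool" where
  "avoids_321 n w \<longleftrightarrow>
     \<not> (\<exists>i j k. 1 \<le> i \<and> i < j \<and> j < k \<and> k \<le> n \<and> w i > w j \<and> w j > w k)"

definition excedances :: "nat \<Rightarrow> (nat \<Rightarrow> nat) \<Rightarrow> nat set" where
  "excedances n w = {i \<in> {1..n}. w i > i}"

definition num_rows :: "nat \<Rightarrow> (nat \<Rightarrow> nat) \<Rightarrow> nat" where
  "num_rows n w = card (excedances n w)"

text \<open>The sequence \<open>f\<^sub>1 < \<dots> < f\<^sub>r\<close>, hence the shift by one of the list index.\<close>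

definition flag :: "nat \<Rightarrow> (nat \<Rightarrow> nat) \<Rightarrow> nat \<Rightarrow> nat" where
  "flag n w i = sorted_list_of_set (excedances n w) ! (i - 1)"

text \<open>
  The defining formulas of \<open>\<lambda>\<^sub>i\<close> and \<open>\<mu>\<^sub>i\<close>, with the positive terms collected so that the
  subtraction on \<open>nat\<close> does not truncate; see the lemma \<open>outer_inner_shape\<close> below.
\<close>

definition outer_shape :: "nat \<Rightarrow> (nat \<Rightarrow> nat) \<Rightarrow> nat \<Rightarrow> nat" where
  "outer_shape n w i =
     (let r = num_rows n w in (w (flag n w r) + i) - (r + flag n w i))"

definition inner_shape :: "nat \<Rightarrow> (nat \<Rightarrow> nat) \<Rightarrow> nat \<Rightarrow> nat" where
  "inner_shape n w i =
     (let r = num_rows n w in (w (flag n w r) + i) - (r + w (flag n w i)))"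

lemma flag_mem:
  assumes "i \<in> {1..num_rows n w}"
  shows "flag n w i \<in> excedances n w"
proof -
  have "finite (excedances n w)" by (simp add: excedances_def)
  moreover have "i - 1 < length (sorted_list_of_set (excedances n w))"
    using assms by (auto simp: num_rows_def)
  ultimately show ?thesis
    unfolding flag_def by (metis nth_mem set_sorted_list_of_set)
qed

lemma flag_less:
  assumes "1 \<le> i" "i < j" "j \<le> num_rows n w"
  shows "flag n w i < flag n w j"
proof -
  have "sorted_wrt (<) (sorted_list_of_set (excedances n w))" by simp
  moreover have "j - 1 < length (sorted_list_of_set (excedances n w))" "i - 1 < j - 1"
    using assms by (auto simp: num_rows_def)
  ultimately show ?thesis
    unfolding flag_def using sorted_wrt_nth_less by blast
qed

lemma excedance_values_less:
  assumes w: "w permutes {1..n}" and avoid: "avoids_321 n w"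
    and i: "i \<in> excedances n w" and j: "j \<in> excedances n w" and "i < j"
  shows "w i < w j"
proof (rule ccontr)
  assume "\<not> w i < w j"
  moreover have "w i \<noteq> w j"
    using permutes_inj[OF w] \<open>i < j\<close> by (simp add: inj_eq)
  ultimately have gt: "w i > w j" by simp
  have "\<exists>k \<in> {j+1..n}. w k \<le> j"
  proof (rule ccontr)
    assume none: "\<not> (\<exists>k \<in> {j+1..n}. w k \<le> j)"
    have "w ` {j+1..n} \<subseteq> {j+1..n}"
    proof
      fix y assume "y \<in> w ` {j+1..n}"
      then obtain k where k: "k \<in> {j+1..n}" "y = w k" by auto
      then have "w k \<in> {1..n}"
        using permutes_in_image[OF w, of k] by auto
      then show "y \<in> {j+1..n}" using none k by force
    qed
    then have "w ` {j+1..n} = {j+1..n}"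
      by (intro endo_inj_surj inj_on_subset[OF permutes_inj[OF w]]) auto
    moreover have "w j \<in> {j+1..n}"
      using j permutes_in_image[OF w, of j] by (auto simp: excedances_def)
    ultimately obtain k where "k \<in> {j+1..n}" "w j = w k" by (metis imageE)
    then show False
      using permutes_inj[OF w] by (simp add: inj_eq)
  qed
  then obtain k where k: "k \<in> {j+1..n}" "w k \<le> j" by blast
  have "1 \<le> i" "w j > w k" using i j k by (auto simp: excedances_def)
  then show False
    using avoid \<open>i < j\<close> gt k unfolding avoids_321_def by auto
qed

lemma outer_inner_shape:
  assumes w: "w permutes {1..n}" and avoid: "avoids_321 n w" and i: "i \<in> {1..num_rows n w}"
  defines "r \<equiv> num_rows n w"
  shows "int (outer_shape n w i) = int (w (flag n w r)) - int r - (int (flag n w i) - int i)"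
    and "int (inner_shape n w i) = int (w (flag n w r)) - int r - (int (w (flag n w i)) - int i)"
proof -
  have gap: "i \<le> k \<Longrightarrow> k \<le> r \<Longrightarrow> w (flag n w i) + (k - i) \<le> w (flag n w k)" for k
  proof (induction k rule: dec_induct)
    case (step k)
    have "w (flag n w k) < w (flag n w (Suc k))"
      using i step(1) step(4)
      by (intro excedance_values_less[OF w avoid] flag_mem flag_less) (auto simp: r_def)
    then show ?case using step by auto
  qed simp
  have "w (flag n w i) + (r - i) \<le> w (flag n w r)" "i \<le> r"
    using gap[of r] i by (auto simp: r_def)
  moreover have "flag n w i < w (flag n w i)"
    using flag_mem[OF i] by (simp add: excedances_def)
  ultimately show
      "int (outer_shape n w i) = int (w (flag n w r)) - int r - (int (flag n w i) - int i)"
      "int (inner_shape n w i) = int (w (flag n w r)) - int r - (int (w (flag n w i)) - int i)"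
    unfolding outer_shape_def inner_shape_def Let_def r_def[symmetric] by linarith+
qed

section \<open>Set-valued tableaux\<close>

definition boxes :: "nat \<Rightarrow> (nat \<Rightarrow> nat) \<Rightarrow> (nat \<Rightarrow> nat) \<Rightarrow> (nat \<times> nat) set" where
  "boxes r lam mu = {(i, j). 1 \<le> i \<and> i \<le> r \<and> mu i < j \<and> j \<le> lam i}"

text \<open>Tableaux are extensional functions on the boxes, so distinct ones differ at some box.\<close>

definition SVT :: "(nat \<times> nat) set \<Rightarrow> (nat \<Rightarrow> nat) \<Rightarrow> (nat \<times> nat \<Rightarrow> nat set) set" where
  "SVT D f =
     {T \<in> (\<Pi>\<^sub>E (i, j) \<in> D. {A. A \<noteq> {} \<and> A \<subseteq> {1..f i}}).
        (\<forall>i j j'. (i, j) \<in> D \<and> (i, j') \<in> D \<and> j < j' \<longrightarrow> Max (T (i, j)) \<le> Min (T (i, j'))) \<and>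
        (\<forall>i i' j. (i, j) \<in> D \<and> (i', j) \<in> D \<and> i < i' \<longrightarrow> Max (T (i, j)) < Min (T (i', j)))}"

text \<open>An entry \<open>((i, j), v)\<close> is a value \<open>v\<close> together with the box \<open>(i, j)\<close> containing it.\<close>

definition entries ::
  "(nat \<times> nat) set \<Rightarrow> (nat \<times> nat \<Rightarrow> nat set) \<Rightarrow> ((nat \<times> nat) \<times> nat) set" where
  "entries D T = Sigma D T"

definition sigma_shape :: "nat \<Rightarrow> (nat \<Rightarrow> nat) \<Rightarrow> (nat \<times> nat) set" where
  "sigma_shape n w = boxes (num_rows n w) (outer_shape n w) (inner_shape n w)"

end

theory Submission
  imports Defs
begin

text \<open>
  Following Fomin and Kirillov, the double Grothendieck polynomial of \<open>w\<close> is the coefficient of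
  \<open>e\<^sub>w\<close> in the product of the factors \<open>1 + (x\<^sub>v \<oplus> b\<^sub>j) u\<^bsub>v+j-1\<^esub>\<close> over the cells \<open>(v, j)\<close> of the
  staircase, taken in an algebra with braid relations and \<open>u\<^sub>k\<^sup>2 = \<beta> u\<^sub>k\<close>: the Yang-Baxter relation
  shows that these coefficients are compatible with the divided differences.  For 321-avoiding
  \<open>w\<close>, a cell \<open>(v, j)\<close> chosen in the expansion of the product becomes an entry \<open>v\<close> in a box of
  content \<open>v + j - 1\<close>.  Removing the last cell \<open>(v, j)\<close> from the product removes the entry \<open>v\<close>
  from the unique outer corner of this content \<open>k\<close>: the box disappears if this was its only entry
  (\<open>w\<close> becomes \<open>w s\<^sub>k\<close>), and a factor \<open>\<beta>\<close> is split off otherwise.  So both sides satisfy the same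
  recursion.
\<close>

text \<open>Divided differences lead down from the longest element, while tableaux grow by corners.
  Prefixes of the staircase product, with the coefficients of arbitrary permutations, provide a
  recursion common to both. A row-wise flag bound cannot express that a single cell is missing. It
  is therefore replaced by the condition that an entry v in a box of content k needs the cell (v, k)
  in the prefix. For the full staircase this amounts to v \<le> k, and since the contents of row r
  run down to its flag value, weakly increasing rows give the flag bound back.

  The reading order serves both sides. The rows after i + 1 use only generators of index above i +
  1, so rows i and i + 1 can be exchanged at the end of the product. On the other side, the last
  cell combines the largest entry with the smallest content available to it, so it can occur only in
  a corner. The parameter t with y \<oplus> t = x is a fraction; the relations carry its denominator
  1 + \<beta> y as a factor, which is cancelled afterwards.\<close>

section \<open>Cancellation in the polynomial ring\<close>

text \<open>The library proves \<open>idom\<close> for polynomial rings only over linearly ordered indeterminates.\<close>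

instantiation indet :: linorder
begin

fun indet_code :: "indet \<Rightarrow> nat" where
  "indet_code (X i) = 2 * i"
| "indet_code (B i) = 2 * i + 1"

definition less_eq_indet :: "indet \<Rightarrow> indet \<Rightarrow> bool" where
  "u \<le> v \<longleftrightarrow> indet_code u \<le> indet_code v"

definition less_indet :: "indet \<Rightarrow> indet \<Rightarrow> bool" where
  "u < v \<longleftrightarrow> indet_code u < indet_code v"

instance
proof
  have inj: "u = v" if "indet_code u = indet_code v" for u v
    using that by (cases u; cases v; simp) presburger+
  show "u = v" if "u \<le> v" "v \<le> u" for u v :: indet
    using that inj by (simp add: less_eq_indet_def)
qed (auto simp: less_eq_indet_def less_indet_def)

end

lemma variable_eq_iff [simp]: "variable u = variable v \<longleftrightarrow> u = v"
  by (metis Poly_Mapping.lookup_single_eq lookup_single_not_eq one_neq_zero variable_def)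

text \<open>The constant coefficient is 1. This permits cancelling the denominator built into
  \<open>exchange\<close>.\<close>

lemma one_plus_beta_variable_nonzero: "1 + \<beta> * variable v \<noteq> 0"
proof
  assume *: "1 + \<beta> * variable v = 0"
  have "Poly_Mapping.lookup (1 + \<beta> * variable v) 0 = 1"
    by (simp add: lookup_add \<beta>_def variable_def mult_single lookup_one lookup_single when_def)
      (metis lookup_single_eq lookup_zero Zero_not_Suc)
  then show False using * by simp
qed

lemma sim_sim [simp]: "sim k \<circ> sim k = id" "sim k (sim k i) = i"
  by (simp_all add: sim_def)

lemma bij_sim [simp]: "bij (sim k)"
  by (simp add: sim_def)

lemma sim_simps [simp]: "sim k k = Suc k" "sim k (Suc k) = k"
  by (simp_all add: sim_def)

lemma sim_other: "i \<noteq> k \<Longrightarrow> i \<noteq> Suc k \<Longrightarrow> sim k i = i"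
  by (simp add: sim_def)

lemma comp_sim_sim [simp]: "w \<circ> sim k \<circ> sim k = w"
  by (simp add: comp_assoc)

lemma permute_x_0 [simp]: "bij s \<Longrightarrow> permute_x s 0 = 0"
  using permute_x_const[of s 0] by simp

lemma permute_x_1 [simp]: "bij s \<Longrightarrow> permute_x s 1 = 1"
  using permute_x_const[of s 1] by simp

lemma permute_x_beta [simp]: "bij s \<Longrightarrow> permute_x s \<beta> = \<beta>"
  using permute_x_const[of s "[:0, 1:]"] by (simp add: \<beta>_def)

lemma permute_x_oplus:
  "bij s \<Longrightarrow> permute_x s (variable u \<oplus> variable v) = variable (rename_x s u) \<oplus> variable (rename_x s v)"
  by (simp add: oplus_def permute_x_add permute_x_mult permute_x_variable)

lemma divided_difference_eqI:
  assumes "(xvar i - xvar (i + 1)) * q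
           = (1 + \<beta> * xvar (i + 1)) * g - (1 + \<beta> * xvar i) * permute_x (sim i) g"
  shows "divided_difference i g = q"
  unfolding divided_difference_def
proof (rule the_equality)
  fix q' assume "(xvar i - xvar (i + 1)) * q'
           = (1 + \<beta> * xvar (i + 1)) * g - (1 + \<beta> * xvar i) * permute_x (sim i) g"
  with assms have "(xvar i - xvar (i + 1)) * q' = (xvar i - xvar (i + 1)) * q"
    by simp
  then show "q' = q" by simp
qed (rule assms)

section \<open>The action of the degenerate Hecke algebra\<close>

type_synonym family = "(nat \<Rightarrow> nat) \<Rightarrow> pol"

text \<open>
  A family \<open>F\<close> stands for the formal sum of the \<open>F w \<cdot> e\<^sub>w\<close>, and the operators below act by right
  multiplication: with the generator \<open>u\<^sub>k\<close>, where \<open>e\<^sub>w u\<^sub>k\<close> is the basis element of \<open>w s\<^sub>k\<close> if \<open>k\<close>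
  is an ascent of \<open>w\<close> and \<open>\<beta> e\<^sub>w\<close> otherwise; with \<open>1 + t u\<^sub>k\<close>; and with a product of such factors
  read from left to right.
\<close>

definition demazure :: "nat \<Rightarrow> family \<Rightarrow> family" where
  "demazure k F w = (if w (Suc k) < w k then F (w \<circ> sim k) + \<beta> * F w else 0)"

definition hecke :: "nat \<Rightarrow> pol \<Rightarrow> family \<Rightarrow> family" where
  "hecke k t F w = F w + t * demazure k F w"

definition act :: "(nat \<times> pol) list \<Rightarrow> family \<Rightarrow> family" where
  "act xs = fold (\<lambda>(k, t). hecke k t) xs"

lemma act_simps [simp]:
  "act [] F = F" "act ((k, t) # xs) F = act xs (hecke k t F)"
  "act (xs @ ys) F = act ys (act xs F)"
  by (simp_all add: act_def)

lemma demazure_linear: "demazure k (\<lambda>w. F w + c * G w) = (\<lambda>w. demazure k F w + c * demazure k G w)"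
  by (auto simp: fun_eq_iff demazure_def algebra_simps)

lemma demazure_scale: "demazure k (\<lambda>w. c * G w) = (\<lambda>w. c * demazure k G w)"
  by (auto simp: fun_eq_iff demazure_def algebra_simps)

lemma demazure_square: "demazure k (demazure k F) = (\<lambda>w. \<beta> * demazure k F w)"
  by (auto simp: fun_eq_iff demazure_def)

lemma demazure_commute:
  assumes "Suc k < l \<or> Suc l < k"
  shows "demazure k (demazure l F) = demazure l (demazure k F)"
proof -
  have eq: "w \<circ> sim k \<circ> sim l = w \<circ> sim l \<circ> sim k" for w :: "nat \<Rightarrow> nat"
    using assms by (auto simp: fun_eq_iff sim_def transpose_def)
  have [simp]: "sim k l = l" "sim k (Suc l) = Suc l" "sim l k = k" "sim l (Suc k) = Suc k"
    using assms by (auto intro: sim_other)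
  show ?thesis
  proof
    fix w :: "nat \<Rightarrow> nat"
    show "demazure k (demazure l F) w = demazure l (demazure k F) w"
      using eq[of w] by (simp add: demazure_def algebra_simps)
  qed
qed

text \<open>Three alternating generators reach only basis elements that decrease along k, k + 1, k +
  2. Both sides vanish at every other w, and at these w they expand to the same terms.\<close>

lemma demazure_braid:
  "demazure k (demazure (Suc k) (demazure k F)) = demazure (Suc k) (demazure k (demazure (Suc k) F))"
proof
  fix w :: "nat \<Rightarrow> nat"
  have braid: "w \<circ> sim k \<circ> sim (Suc k) \<circ> sim k = w \<circ> sim (Suc k) \<circ> sim k \<circ> sim (Suc k)"
    by (auto simp: fun_eq_iff sim_def transpose_def)
  show "demazure k (demazure (Suc k) (demazure k F)) w
      = demazure (Suc k) (demazure k (demazure (Suc k) F)) w"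
  proof (cases "w (Suc (Suc k)) < w (Suc k) \<and> w (Suc k) < w k")
    case True
    then show ?thesis
      by (simp add: demazure_def sim_other braid algebra_simps)
  next
    case False
    then show ?thesis
      by (auto simp: demazure_def sim_other)
  qed
qed

lemma hecke_eq: "hecke k t F = (\<lambda>w. F w + t * demazure k F w)"
  by (simp add: fun_eq_iff hecke_def)

lemma hecke_commute:
  assumes "Suc k < l \<or> Suc l < k"
  shows "hecke k t (hecke l s F) = hecke l s (hecke k t F)"
  by (simp add: hecke_eq demazure_linear demazure_commute[OF assms] algebra_simps)

section \<open>Exchange operators and the Yang-Baxter relation\<close>

text \<open>
  This is \<open>1 + t u\<^sub>k\<close> for the \<open>t\<close> with \<open>y \<oplus> t = x\<close>, that is \<open>t = (x - y) / (1 + \<beta> y)\<close>, multiplied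
  by the denominator.
\<close>

definition exchange :: "nat \<Rightarrow> pol \<Rightarrow> pol \<Rightarrow> family \<Rightarrow> family" where
  "exchange k y x F w = (1 + \<beta> * y) * F w + (x - y) * demazure k F w"

lemma exchange_eq: "exchange k y x F = (\<lambda>w. (1 + \<beta> * y) * F w + (x - y) * demazure k F w)"
  by (simp add: fun_eq_iff exchange_def)

lemma demazure_linear2:
  "demazure k (\<lambda>w. c * F w + d * G w) = (\<lambda>w. c * demazure k F w + d * demazure k G w)"
  by (auto simp: fun_eq_iff demazure_def algebra_simps)

lemma hecke_scale: "hecke k t (\<lambda>w. c * F w) = (\<lambda>w. c * hecke k t F w)"
  by (simp add: fun_eq_iff hecke_def demazure_scale algebra_simps)

lemma act_scale: "act xs (\<lambda>w. c * F w) = (\<lambda>w. c * act xs F w)"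
  by (induction xs arbitrary: F) (auto simp: hecke_scale)

lemma hecke_exchange_commute:
  assumes "Suc k < l \<or> Suc l < k"
  shows "hecke l t (exchange k y x F) = exchange k y x (hecke l t F)"
  using assms
  by (intro ext, simp only: hecke_eq exchange_eq demazure_linear demazure_linear2 demazure_scale
        demazure_commute[OF assms])
     (simp add: algebra_simps)

lemma act_exchange_commute:
  assumes "\<And>l t. (l, t) \<in> set xs \<Longrightarrow> Suc k < l \<or> Suc l < k"
  shows "act xs (exchange k y x F) = exchange k y x (act xs F)"
  using assms
proof (induction xs arbitrary: F)
  case (Cons a xs)
  obtain l t where a: "a = (l, t)" by fastforce
  have "act xs (exchange k y x G) = exchange k y x (act xs G)" for G
    using Cons.prems by (intro Cons.IH) auto
  moreover have "Suc k < l \<or> Suc l < k" using Cons.prems a by auto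
  ultimately show ?case by (simp add: a hecke_exchange_commute)
qed simp

lemma act_hecke_commute:
  assumes "\<And>l t. (l, t) \<in> set xs \<Longrightarrow> Suc k < l \<or> Suc l < k"
  shows "act xs (hecke k s F) = hecke k s (act xs F)"
  using assms
proof (induction xs arbitrary: F)
  case (Cons a xs)
  obtain l t where a: "a = (l, t)" by fastforce
  have "act xs (hecke k s G) = hecke k s (act xs G)" for G
    using Cons.prems by (intro Cons.IH) auto
  moreover have "Suc k < l \<or> Suc l < k" using Cons.prems a by auto
  ultimately show ?case by (simp add: a hecke_commute[of k l s t F, symmetric])
qed simp

text \<open>With y \<oplus> t = x, this is x \<oplus> b = (y \<oplus> b) \<oplus> t, multiplied by 1
  + \<beta> y.\<close>

lemma oplus_exchange:
  "(x \<oplus> b) * (1 + \<beta> * y) = (x - y) + (y \<oplus> b) * (1 + \<beta> * y) + (y \<oplus> b) * (x - y) * \<beta>"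
  by (simp add: oplus_def algebra_simps)

text \<open>Because \<open>u\<^sub>k\<^sup>2 = \<beta> u\<^sub>k\<close>, factors of equal index
  multiply by taking \<oplus> of their parameters.\<close>

lemma exchange_same:
  "exchange k y x (hecke k (y \<oplus> b) F) = (\<lambda>w. (1 + \<beta> * y) * hecke k (x \<oplus> b) F w)"
proof
  fix w
  have "exchange k y x (hecke k (y \<oplus> b) F) w
    = (1 + \<beta> * y) * F w
      + ((x - y) + (y \<oplus> b) * (1 + \<beta> * y) + (y \<oplus> b) * (x - y) * \<beta>) * demazure k F w"
    by (simp add: exchange_eq hecke_eq demazure_linear demazure_square algebra_simps)
  then show "exchange k y x (hecke k (y \<oplus> b) F) w = (1 + \<beta> * y) * hecke k (x \<oplus> b) F w"
    by (simp only: oplus_exchange[symmetric] hecke_def) (simp add: algebra_simps)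
qed

text \<open>The middle parameter is the \<oplus>-sum of the outer two. After expansion and the braid
  relation, only the coefficients of the single generators differ in form, and \<open>qs\<close>
  identifies them.\<close>

lemma yang_baxter:
  "exchange k y x (hecke (Suc k) (x \<oplus> b) (hecke k (y \<oplus> b) F))
   = hecke (Suc k) (y \<oplus> b) (hecke k (x \<oplus> b) (exchange (Suc k) y x F))"
proof
  fix w
  define p q s d where "p = y \<oplus> b" and "q = x \<oplus> b" and "s = 1 + \<beta> * y" and "d = x - y"
  have qs: "q * s = d + p * s + p * d * \<beta>"
    unfolding p_def q_def s_def d_def by (rule oplus_exchange)
  let ?a = "demazure k" and ?b = "demazure (Suc k)"
  have "exchange k y x (hecke (Suc k) q (hecke k p F)) w
     = s * F w + (d + p * s + p * d * \<beta>) * ?a F w + s * q * ?b F w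
       + d * q * ?a (?b F) w + p * q * s * ?b (?a F) w + p * q * d * ?a (?b (?a F)) w"
    by (simp add: exchange_eq hecke_eq demazure_linear demazure_linear2 demazure_scale
        demazure_square s_def[symmetric] d_def[symmetric]) (simp add: algebra_simps)
  moreover have "hecke (Suc k) p (hecke k q (exchange (Suc k) y x F)) w
     = s * F w + s * q * ?a F w + (d + p * s + p * d * \<beta>) * ?b F w
       + d * q * ?a (?b F) w + p * q * s * ?b (?a F) w + p * q * d * ?a (?b (?a F)) w"
    by (simp add: exchange_eq hecke_eq demazure_linear demazure_linear2 demazure_scale
        demazure_square demazure_braid s_def[symmetric] d_def[symmetric]) (simp add: algebra_simps)
  ultimately show "exchange k y x (hecke (Suc k) (x \<oplus> b) (hecke k (y \<oplus> b) F)) w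
    = hecke (Suc k) (y \<oplus> b) (hecke k (x \<oplus> b) (exchange (Suc k) y x F)) w"
    using qs unfolding p_def[symmetric] q_def[symmetric] by (simp add: mult.commute)
qed

text \<open>Along a staircase row the indices of the generator and of b rise together, and the
  reading goes from right to left. The factor of smallest index k thus comes last, beside an
  exchange operator applied afterwards.\<close>

fun row :: "nat \<Rightarrow> nat \<Rightarrow> nat \<Rightarrow> pol \<Rightarrow> (nat \<times> pol) list" where
  "row 0 k j x = []"
| "row (Suc m) k j x = row m (Suc k) (Suc j) x @ [(k, x \<oplus> bvar j)]"

lemma row_generator: "(l, t) \<in> set (row m k j x) \<Longrightarrow> k \<le> l"
  by (induction m arbitrary: k j) fastforce+

text \<open>
  Commuting past distant generators brings the factor of index \<open>k\<close> next to the exchange operator,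
  where the Yang-Baxter relation shifts the latter to index \<open>k + 1\<close> and the shorter rows.
\<close>

lemma row_exchange:
  "exchange k y x (act (row (Suc m) k j y @ row m (Suc k) j x) F)
   = (\<lambda>w. (1 + \<beta> * y) * act (row (Suc m) k j x @ row m (Suc k) j y) F w)"
proof (induction m arbitrary: k j F)
  case 0
  show ?case by (simp add: exchange_same)
next
  case (Suc m)
  define U where "U z = row (Suc m) (Suc k) (Suc j) z" for z
  define V where "V z = row m (Suc (Suc k)) (Suc j) z" for z
  have V: "act (V z) (hecke k s G) = hecke k s (act (V z) G)" for z s G
    using row_generator by (intro act_hecke_commute) (fastforce simp: V_def)
  have split: "act (row (Suc (Suc m)) k j z @ row (Suc m) (Suc k) j z') F
     = hecke (Suc k) (z' \<oplus> bvar j) (hecke k (z \<oplus> bvar j) (act (U z @ V z') F))" for z z'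
    by (simp add: V[symmetric]) (simp add: U_def V_def)
  have IH: "exchange (Suc k) y x (act (U y @ V x) F) = (\<lambda>w. (1 + \<beta> * y) * act (U x @ V y) F w)"
    unfolding U_def V_def by (rule Suc.IH)
  show ?case
    unfolding split yang_baxter IH by (simp add: hecke_scale)
qed

lemma permute_x_act:
  assumes "bij s" "\<And>w. permute_x s (F w) = F w"
  shows "permute_x s (act xs F w) = act (map (\<lambda>(k, t). (k, permute_x s t)) xs) F w"
proof (induction xs arbitrary: w rule: rev_induct)
  case (snoc a xs)
  obtain k t where a: "a = (k, t)" by fastforce
  show ?case
    using assms(1)
    by (simp add: a hecke_def demazure_def permute_x_add permute_x_mult snoc.IH del: comp_apply)
qed (simp add: assms)

section \<open>Double Grothendieck polynomials as coefficients\<close>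

definition unit_family :: family where
  "unit_family w = (if w = id then 1 else 0)"

text \<open>
  The cell \<open>(v, k)\<close> lies in row \<open>v\<close> and column \<open>k - v + 1\<close> of the staircase of pipe dreams, which
  is read row by row and from right to left.
\<close>

definition cells :: "nat \<Rightarrow> (nat \<times> nat) list" where
  "cells n = concat (map (\<lambda>v. map (Pair v) (rev [v..<n])) [1..<Suc n])"

definition cell_weight :: "nat \<Rightarrow> nat \<Rightarrow> pol" where
  "cell_weight v k = xvar v \<oplus> bvar (k + 1 - v)"

definition weighted :: "(nat \<times> nat) list \<Rightarrow> (nat \<times> pol) list" where
  "weighted cs = map (\<lambda>(v, k). (k, cell_weight v k)) cs"

definition coeff_family :: "nat \<Rightarrow> family" where
  "coeff_family n = act (weighted (cells n)) unit_family"

lemma row_eq_map: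
  "row m k j x = map (\<lambda>l. (l, x \<oplus> bvar (l + j - k))) (rev [k..<k + m])"
proof (induction m arbitrary: k j)
  case (Suc m)
  have "[k..<k + Suc m] = k # [Suc k..<Suc k + m]"
    by (simp add: upt_conv_Cons)
  then show ?case
    by (auto simp: Suc simp del: upt_Suc)
qed simp

lemma weighted_row:
  "weighted (map (Pair v) (rev [v..<n])) = row (n - v) v 1 (xvar v)"
proof (cases "v \<le> n")
  case True
  then have "[v..<n] = [v..<v + (n - v)]" by simp
  then show ?thesis
    by (simp add: weighted_def row_eq_map cell_weight_def split_def comp_def)
qed (simp add: weighted_def)

text \<open>Swapping \<open>xvar i\<close> and \<open>xvar (Suc i)\<close> swaps the parameters of
  rows i and i + 1. \<open>exchange\<close> passes the later rows, whose generators have index at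
  least i + 2, and \<open>row_exchange\<close> restores the two rows; the earlier rows belong to the
  family acted on.\<close>

lemma coeff_family_exchange:
  assumes i: "1 \<le> i" "i < n"
  shows "(1 + \<beta> * xvar (Suc i)) * coeff_family n w
     = exchange i (xvar (Suc i)) (xvar i) (\<lambda>u. permute_x (sim i) (coeff_family n u)) w"
proof -
  define C where "C vs = weighted (concat (map (\<lambda>v. map (Pair v) (rev [v..<n])) vs))" for vs
  define C1 where "C1 = C [1..<i]"
  define C2 where "C2 = C [Suc (Suc i)..<Suc n]"
  define m where "m = n - Suc i"
  have C_append: "C (xs @ ys) = C xs @ C ys" for xs ys
    by (simp add: C_def weighted_def)
  have C_single: "C [v] = row (n - v) v 1 (xvar v)" for v
    using weighted_row[of v n] by (simp add: C_def)
  have "[1..<Suc n] = [1..<i] @ [i] @ [Suc i] @ [Suc (Suc i)..<Suc n]"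
    using i upt_add_eq_append[of 1 i "Suc n - i"]
    by (simp add: upt_conv_Cons)
  then have cells: "weighted (cells n) = C1 @ row (Suc m) i 1 (xvar i) @ row m (Suc i) 1 (xvar (Suc i)) @ C2"
    using i Suc_diff_Suc[of i n]
    unfolding cells_def C_def[symmetric] C1_def C2_def m_def
    by (simp only: C_append C_single append_assoc)
  let ?p = "map (\<lambda>(k, t). (k, permute_x (sim i) t))"
  have p_C: "?p (C vs) = C vs" if "\<And>v. v \<in> set vs \<Longrightarrow> v \<noteq> i \<and> v \<noteq> Suc i" for vs
    using that by (auto simp: C_def weighted_def cell_weight_def permute_x_oplus sim_other)
  have p_C1: "?p C1 = C1"
    unfolding C1_def by (rule p_C) auto
  have p_C2: "?p C2 = C2"
    unfolding C2_def by (rule p_C) auto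
  have p_row: "?p (row m' k j (xvar v)) = row m' k j (xvar (sim i v))" for m' k j v
    by (induction m' arbitrary: k j) (auto simp: permute_x_oplus)
  have unit: "permute_x (sim i) (unit_family u) = unit_family u" for u
    by (simp add: unit_family_def)
  have "(\<lambda>u. permute_x (sim i) (coeff_family n u))
      = act (?p (weighted (cells n))) unit_family"
    unfolding coeff_family_def by (intro ext permute_x_act bij_sim unit)
  also have "?p (weighted (cells n)) = C1 @ row (Suc m) i 1 (xvar (Suc i)) @ row m (Suc i) 1 (xvar i) @ C2"
    unfolding cells map_append p_row p_C1 p_C2 by simp
  finally have permuted: "(\<lambda>u. permute_x (sim i) (coeff_family n u))
      = act C2 (act (row (Suc m) i 1 (xvar (Suc i)) @ row m (Suc i) 1 (xvar i)) (act C1 unit_family))"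
    by simp
  have "exchange i (xvar (Suc i)) (xvar i) (\<lambda>u. permute_x (sim i) (coeff_family n u))
     = act C2 (exchange i (xvar (Suc i)) (xvar i)
        (act (row (Suc m) i 1 (xvar (Suc i)) @ row m (Suc i) 1 (xvar i)) (act C1 unit_family)))"
    unfolding permuted
    by (rule act_exchange_commute[symmetric]) (auto simp: C2_def C_def weighted_def)
  also have "\<dots> = (\<lambda>u. (1 + \<beta> * xvar (Suc i)) * coeff_family n u)"
    unfolding row_exchange act_scale coeff_family_def cells by simp
  finally show ?thesis by simp
qed

text \<open>Two coefficients of \<open>coeff_family_exchange\<close> are compared. At the ascent w
  they give invariance under \<open>sim i\<close>; at \<open>w \<circ> sim i\<close> they then give
  the equation of the divided difference.\<close>

lemma divided_difference_coeff_family: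
  assumes i: "1 \<le> i" "i < n" and asc: "w i < w (Suc i)"
  shows "divided_difference i (coeff_family n (w \<circ> sim i)) = coeff_family n w"
proof (rule divided_difference_eqI)
  let ?G = "coeff_family n" and ?x = "xvar i" and ?y = "xvar (Suc i)"
  let ?P = "\<lambda>u. permute_x (sim i) (?G u)"
  have "(1 + \<beta> * ?y) * ?G w = (1 + \<beta> * ?y) * ?P w"
    using coeff_family_exchange[OF i, of w] asc by (simp add: exchange_def demazure_def)
  then have sym: "?P w = ?G w"
    using one_plus_beta_variable_nonzero[of "X (Suc i)"] by simp
  have "(1 + \<beta> * ?y) * ?G (w \<circ> sim i)
      = (1 + \<beta> * ?y) * ?P (w \<circ> sim i) + (?x - ?y) * (?P w + \<beta> * ?P (w \<circ> sim i))"
    using coeff_family_exchange[OF i, of "w \<circ> sim i"] asc by (simp add: exchange_def demazure_def)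
  then show "(xvar i - xvar (i + 1)) * ?G w
      = (1 + \<beta> * xvar (i + 1)) * ?G (w \<circ> sim i) - (1 + \<beta> * xvar i) * ?P (w \<circ> sim i)"
    by (simp add: sym algebra_simps)
qed

section \<open>Coxeter length\<close>

definition inversions :: "nat \<Rightarrow> (nat \<Rightarrow> nat) \<Rightarrow> (nat \<times> nat) set" where
  "inversions n w = {(i, j). 1 \<le> i \<and> i < j \<and> j \<le> n \<and> w j < w i}"

lemma finite_inversions [simp]: "finite (inversions n w)"
  by (rule finite_subset[of _ "{1..n} \<times> {1..n}"]) (auto simp: inversions_def)

lemma sim_less:
  assumes "i < j" "(i, j) \<noteq> (k, Suc k)"
  shows "sim k i < sim k j"
  using assms by (auto simp: sim_def transpose_def)

lemma sim_permutes: "k \<in> {1..<n} \<Longrightarrow> sim k permutes {1..n}"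
  by (auto simp: sim_def intro: permutes_swap_id)

lemma sim_mem: "k \<in> {1..<n} \<Longrightarrow> sim k i \<in> {1..n} \<longleftrightarrow> i \<in> {1..n}"
  by (rule permutes_in_image[OF sim_permutes])

lemma permutes_comp_sim: "w permutes {1..n} \<Longrightarrow> k \<in> {1..<n} \<Longrightarrow> w \<circ> sim k permutes {1..n}"
  by (rule permutes_compose[OF sim_permutes])

text \<open>Applying \<open>sim k\<close> to both positions keeps the order of every pair except (k,
  k + 1), which becomes the one new inversion.\<close>

lemma inversions_ascent:
  assumes k: "k \<in> {1..<n}" and asc: "w k < w (Suc k)"
  shows "card (inversions n (w \<circ> sim k)) = Suc (card (inversions n w))"
proof -
  let ?s = "map_prod (sim k) (sim k)"
  have bound: "1 \<le> sim k i \<and> sim k i \<le> n" if "1 \<le> i" "i \<le> n" for i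
    using sim_mem[OF k, of i] that by auto
  have "inversions n (w \<circ> sim k) = insert (k, Suc k) (?s ` inversions n w)"
  proof (intro equalityI subsetI)
    fix p assume "p \<in> inversions n (w \<circ> sim k)"
    then obtain i j where p: "p = (i, j)" and ij: "1 \<le> i" "i < j" "j \<le> n" "w (sim k j) < w (sim k i)"
      by (auto simp: inversions_def)
    show "p \<in> insert (k, Suc k) (?s ` inversions n w)"
    proof (cases "p = (k, Suc k)")
      case False
      then have "(sim k i, sim k j) \<in> inversions n w"
        using ij bound[of i] bound[of j] sim_less[of i j k] by (auto simp: inversions_def p)
      then show ?thesis
        by (auto simp: p intro!: image_eqI[where x = "(sim k i, sim k j)"])
    qed simp
  next
    fix p assume "p \<in> insert (k, Suc k) (?s ` inversions n w)"
    then consider "p = (k, Suc k)" | i j where "(i, j) \<in> inversions n w" "p = (sim k i, sim k j)"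
      by auto
    then show "p \<in> inversions n (w \<circ> sim k)"
    proof cases
      case 1
      then show ?thesis using k asc by (auto simp: inversions_def)
    next
      case 2
      then have ij: "1 \<le> i" "i < j" "j \<le> n" "w j < w i" by (auto simp: inversions_def)
      with asc have "(i, j) \<noteq> (k, Suc k)" by auto
      then show ?thesis
        using ij 2 bound[of i] bound[of j] sim_less[of i j k] by (auto simp: inversions_def)
    qed
  qed
  moreover have "(k, Suc k) \<notin> ?s ` inversions n w"
  proof
    assume "(k, Suc k) \<in> ?s ` inversions n w"
    then obtain i j where "(i, j) \<in> inversions n w" "sim k i = k" "sim k j = Suc k" by auto
    then have "i = Suc k" "j = k" "i < j"
      using sim_sim(2)[of k i] sim_sim(2)[of k j] by (auto simp: inversions_def)
    then show False by simp
  qed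
  moreover have "inj ?s"
    by (intro map_prod_inj_on[of _ UNIV _ UNIV, simplified] bij_is_inj bij_sim)
  ultimately show ?thesis
    by (simp add: card_image inj_on_subset)
qed

lemma inversions_descent:
  assumes "k \<in> {1..<n}" "w (Suc k) < w k"
  shows "card (inversions n w) = Suc (card (inversions n (w \<circ> sim k)))"
  using inversions_ascent[of k n "w \<circ> sim k"] assms by simp

lemma no_descent_imp_id:
  assumes w: "w permutes {1..n}" and asc: "\<And>k. k \<in> {1..<n} \<Longrightarrow> w k < w (Suc k)"
  shows "w = id"
proof (rule permutes_natset_ge[OF w], intro ballI)
  have "1 \<le> i \<Longrightarrow> i \<le> n \<Longrightarrow> i \<le> w i" for i
  proof (induction i rule: dec_induct)
    case base
    then have "w 1 \<in> {1..n}" using permutes_in_image[OF w, of 1] by simp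
    then show ?case by simp
  next
    case (step i)
    then show ?case using asc[of i] by auto
  qed
  then show "i \<le> w i" if "i \<in> {1..n}" for i using that by simp
qed

section \<open>Words in the simple transpositions\<close>

definition word :: "nat list \<Rightarrow> nat \<Rightarrow> nat" where
  "word is = foldr (\<lambda>i u. sim i \<circ> u) is id"

lemma word_Nil [simp]: "word [] = id"
  by (simp add: word_def)

lemma word_Cons: "word (k # ks) = sim k \<circ> word ks"
  by (simp add: word_def)

lemma word_append: "word (xs @ ys) = word xs \<circ> word ys"
  by (induction xs) (simp_all add: word_Cons comp_assoc)

lemma word_snoc: "word (xs @ [k]) = word xs \<circ> sim k"
  by (simp add: word_append word_Cons)

lemma word_permutes: "set ks \<subseteq> {1..<n} \<Longrightarrow> word ks permutes {1..n}"
proof (induction ks rule: rev_induct)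
  case (snoc k ks)
  then have "word ks permutes {1..n}" "k \<in> {1..<n}" by auto
  then show ?case unfolding word_snoc by (rule permutes_comp_sim)
qed (simp add: permutes_id)

lemma card_inversions_word: "set ks \<subseteq> {1..<n} \<Longrightarrow> card (inversions n (word ks)) \<le> length ks"
proof (induction ks rule: rev_induct)
  case Nil
  then show ?case by (auto simp: inversions_def card_eq_0_iff)
next
  case (snoc k ks)
  then have k: "k \<in> {1..<n}" and IH: "card (inversions n (word ks)) \<le> length ks" by auto
  have "word ks permutes {1..n}" using snoc.prems by (intro word_permutes) auto
  then have "word ks k \<noteq> word ks (Suc k)"
    by (metis n_not_Suc_n permutes_inj inj_eq)
  then consider "word ks k < word ks (Suc k)" | "word ks (Suc k) < word ks k" by linarith
  then show ?case
    using inversions_ascent[OF k, of "word ks"] inversions_descent[OF k, of "word ks"] IH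
    by cases (auto simp: word_snoc simp del: comp_apply)
qed

text \<open>Cancelling a descent on the right lowers the inversion number by one, and only the
  identity has no descent.\<close>

lemma reduced_word_exists:
  assumes "w permutes {1..n}"
  shows "\<exists>ks. set ks \<subseteq> {1..<n} \<and> length ks = card (inversions n w) \<and> w = word ks"
  using assms
proof (induction "card (inversions n w)" arbitrary: w)
  case 0
  have "w k < w (Suc k)" if "k \<in> {1..<n}" for k
  proof -
    have "w k \<noteq> w (Suc k)" by (metis n_not_Suc_n permutes_inj[OF 0(2)] inj_eq)
    then show ?thesis using inversions_descent[OF that, of w] 0(1) by force
  qed
  then have "w = id" by (rule no_descent_imp_id[OF 0(2)])
  then show ?case using 0(1) by (intro exI[of _ "[]"]) auto
next
  case (Suc m)
  have "\<exists>k \<in> {1..<n}. w (Suc k) < w k"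
  proof (rule ccontr)
    assume none: "\<not> (\<exists>k \<in> {1..<n}. w (Suc k) < w k)"
    have "w k < w (Suc k)" if "k \<in> {1..<n}" for k
    proof -
      have "w k \<noteq> w (Suc k)" by (metis n_not_Suc_n permutes_inj[OF Suc.prems] inj_eq)
      then show ?thesis using none that by force
    qed
    then have "w = id" by (rule no_descent_imp_id[OF Suc.prems])
    then have "inversions n w = {}" by (auto simp: inversions_def)
    then show False using Suc.hyps(2) by simp
  qed
  then obtain k where k: "k \<in> {1..<n}" "w (Suc k) < w k" by blast
  then have "m = card (inversions n (w \<circ> sim k))"
    using inversions_descent[OF k] Suc.hyps(2) by simp
  then obtain ks where ks: "set ks \<subseteq> {1..<n}" "length ks = m" "w \<circ> sim k = word ks"
    using Suc.hyps(1)[of "w \<circ> sim k"] permutes_comp_sim[OF Suc.prems k(1)] by auto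
  have "w = word (ks @ [k])"
    by (simp add: word_snoc ks(3)[symmetric])
  then show ?case
    using ks k Suc.hyps(2) by (intro exI[of _ "ks @ [k]"]) auto
qed

lemma coxeter_length_eq:
  assumes "w permutes {1..n}"
  shows "coxeter_length n w = card (inversions n w)"
  unfolding coxeter_length_def
proof (rule Least_equality)
  show "\<exists>is. length is = card (inversions n w) \<and> set is \<subseteq> {1..<n}
      \<and> w = foldr (\<lambda>i u. sim i \<circ> u) is id"
    using reduced_word_exists[OF assms] by (auto simp: word_def)
next
  fix l assume "\<exists>is. length is = l \<and> set is \<subseteq> {1..<n} \<and> w = foldr (\<lambda>i u. sim i \<circ> u) is id"
  then show "card (inversions n w) \<le> l"
    using card_inversions_word by (auto simp: word_def)
qed

section \<open>The longest element\<close>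

definition reversal :: "nat \<Rightarrow> nat \<Rightarrow> nat" where
  "reversal n i = (if 1 \<le> i \<and> i \<le> n then n + 1 - i else i)"

lemma reversal_reversal [simp]: "reversal n \<circ> reversal n = id"
  by (auto simp: fun_eq_iff reversal_def)

lemma reversal_permutes: "reversal n permutes {1..n}"
proof (rule bij_imp_permutes)
  show "bij_betw (reversal n) {1..n} {1..n}"
    by (rule bij_betw_byWitness[where f' = "reversal n"]) (auto simp: reversal_def)
qed (auto simp: reversal_def)

lemma no_ascent_imp_reversal:
  assumes w: "w permutes {1..n}" and desc: "\<And>k. k \<in> {1..<n} \<Longrightarrow> \<not> w k < w (Suc k)"
  shows "w = reversal n"
proof -
  have "w \<circ> reversal n = id"
  proof (rule no_descent_imp_id)
    show "w \<circ> reversal n permutes {1..n}"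
      by (rule permutes_compose[OF reversal_permutes w])
    fix k assume k: "k \<in> {1..<n}"
    then have "\<not> w (n - k) < w (Suc (n - k))" by (intro desc) auto
    moreover have "w (n - k) \<noteq> w (Suc (n - k))" by (metis n_not_Suc_n permutes_inj[OF w] inj_eq)
    ultimately show "(w \<circ> reversal n) k < (w \<circ> reversal n) (Suc k)"
      using k by (simp add: reversal_def Suc_diff_le)
  qed
  then have "w \<circ> reversal n \<circ> reversal n = reversal n" by simp
  then show ?thesis by (simp add: comp_assoc)
qed

lemma longest_eq_reversal: "longest n = reversal n"
proof -
  let ?P = "\<lambda>w. w permutes {1..n}"
  \<comment> \<open>\<open>ARG_MAX\<close> is known to yield a maximiser once the lengths are
    bounded.\<close>
  have "coxeter_length n w < Suc (card ({1..n} \<times> {1..n}))" if "?P w" for w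
    unfolding coxeter_length_eq[OF that]
    by (intro le_imp_less_Suc card_mono) (auto simp: inversions_def)
  then have L: "?P (longest n)" "\<And>w. ?P w \<Longrightarrow> coxeter_length n w \<le> coxeter_length n (longest n)"
    using arg_max_nat_lemma[where P = ?P and f = "coxeter_length n" and k = id] permutes_id
    unfolding longest_def by blast+
  show ?thesis
  proof (rule no_ascent_imp_reversal[OF L(1)], rule notI)
    fix k assume k: "k \<in> {1..<n}" "longest n k < longest n (Suc k)"
    then have "coxeter_length n (longest n \<circ> sim k) \<le> coxeter_length n (longest n)"
      by (intro L(2) permutes_comp_sim L(1))
    then show False
      using inversions_ascent[OF k] coxeter_length_eq[OF L(1)]
        coxeter_length_eq[OF permutes_comp_sim[OF L(1) k(1)]] by simp
  qed
qed

section \<open>Identification of the Grothendieck polynomials\<close>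

definition cell_less :: "nat \<times> nat \<Rightarrow> nat \<times> nat \<Rightarrow> bool" where
  "cell_less = (\<lambda>(v, k) (v', k'). v < v' \<or> (v = v' \<and> k' < k))"

lemma set_cells: "set (cells n) = {(v, k). 1 \<le> v \<and> v \<le> k \<and> k < n}"
  by (force simp: cells_def simp del: upt_Suc)

lemma sorted_wrt_cells: "sorted_wrt cell_less (cells n)"
proof -
  have row: "sorted_wrt cell_less (map (Pair v) (rev [v..<n]))" for v
    by (simp add: sorted_wrt_map sorted_wrt_rev cell_less_def)
  have "sorted_wrt cell_less (concat (map (\<lambda>v. map (Pair v) (rev [v..<n])) vs))"
    if "sorted_wrt (<) vs" for vs
    using that by (induction vs) (auto simp: sorted_wrt_append row, auto simp: cell_less_def)
  then show ?thesis by (simp add: cells_def)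
qed

lemma distinct_cells: "distinct (cells n)"
proof -
  have "sorted_wrt cell_less cs \<Longrightarrow> distinct cs" for cs
    by (induction cs) (auto simp: cell_less_def)
  then show ?thesis using sorted_wrt_cells by blast
qed

text \<open>Position v travels through all the transpositions up to n; each later position up to n
  is met once and moves down.\<close>

lemma word_row: "v \<le> n \<Longrightarrow> word (rev [v..<n]) i = (if i = v then n else if v < i \<and> i \<le> n then i - 1 else i)"
proof (induction n arbitrary: i rule: dec_induct)
  case (step n)
  then show ?case by (auto simp: word_Cons sim_def transpose_def)
qed auto

lemma word_cells: "word (map snd (cells n)) = reversal n"
proof -
  \<comment> \<open>Downward induction on the first row: rows i to n multiply to the reversal of the
    interval from i to n.\<close>
  have "word (map snd (concat (map (\<lambda>v. map (Pair v) (rev [v..<n])) [i..<Suc n]))) j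
      = (if i \<le> j \<and> j \<le> n then n + i - j else j)" if "i \<le> Suc n" for i j
    using that
  proof (induction i arbitrary: j rule: inc_induct)
    case (step i)
    then have "[i..<Suc n] = i # [Suc i..<Suc n]" by (simp add: upt_conv_Cons)
    with step show ?case
      by (auto simp: word_append word_row comp_def simp del: upt_Suc)
  qed auto
  from this[of 1] show ?thesis
    by (auto simp: fun_eq_iff cells_def reversal_def)
qed

lemma card_inversions_reversal: "card (inversions n (reversal n)) = length (cells n)"
proof -
  have "inversions n (reversal n) = (\<lambda>(v, k). (v, Suc k)) ` set (cells n)"
  proof (intro equalityI subsetI)
    fix p assume "p \<in> inversions n (reversal n)"
    then show "p \<in> (\<lambda>(v, k). (v, Suc k)) ` set (cells n)"
      by (cases p) (auto simp: inversions_def set_cells intro!: image_eqI[where x = "(fst p, snd p - 1)"])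
  qed (auto simp: inversions_def set_cells reversal_def)
  moreover have "inj_on (\<lambda>(v, k). (v, Suc k)) (set (cells n))" by (auto simp: inj_on_def)
  ultimately show ?thesis
    by (simp add: card_image distinct_card distinct_cells)
qed

text \<open>Each factor adds at most one inversion, so with exactly enough factors the generator
  must be taken from every one. The second part needs the first for the terms in which the last
  factor adds no inversion.\<close>

lemma act_unit_long:
  assumes "set (map fst xs) \<subseteq> {1..<n}"
  shows "length xs < card (inversions n w) \<Longrightarrow> act xs unit_family w = 0"
    and "length xs = card (inversions n w) \<Longrightarrow>
      act xs unit_family w = (if w = word (map fst xs) then prod_list (map snd xs) else 0)"
  using assms
proof (induction xs arbitrary: w rule: rev_induct)
  case Nil
  {
    case 1
    then have "w \<noteq> id" by (auto simp: inversions_def dest!: card_gt_0_iff[THEN iffD1])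
    then show ?case by (simp add: unit_family_def)
  next
    case 2
    then show ?case by (auto simp: unit_family_def)
  }
next
  case (snoc a xs)
  obtain k t where a: "a = (k, t)" by fastforce
  {
    case 1
    then have k: "k \<in> {1..<n}" by (simp add: a)
    from 1 show ?case
      using snoc.IH(1)[of w] snoc.IH(1)[of "w \<circ> sim k"] inversions_descent[OF k, of w]
      by (auto simp: a hecke_def demazure_def simp del: comp_apply)
  next
    case 2
    then have k: "k \<in> {1..<n}" by (simp add: a)
    have 0: "act xs unit_family w = 0" using 2 by (intro snoc.IH(1)) auto
    show ?case
    proof (cases "w (Suc k) < w k")
      case True
      have "w = word (map fst xs) \<circ> sim k \<longleftrightarrow> w \<circ> sim k = word (map fst xs)"
        by (metis comp_sim_sim)
      then show ?thesis
        using True 2 0 snoc.IH(2)[of "w \<circ> sim k"] inversions_descent[OF k, of w]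
        by (auto simp: a hecke_def demazure_def word_snoc simp del: comp_apply)
    next
      case False
      \<comment> \<open>Otherwise the word of \<open>xs\<close> would have more inversions than
        letters.\<close>
      have "w \<noteq> word (map fst xs) \<circ> sim k"
      proof
        assume w: "w = word (map fst xs) \<circ> sim k"
        have xs: "set (map fst xs) \<subseteq> {1..<n}" using 2 by auto
        have "w permutes {1..n}"
          unfolding w by (intro permutes_comp_sim word_permutes xs k)
        then have "w k \<noteq> w (Suc k)" by (metis n_not_Suc_n permutes_inj inj_eq)
        then have "w k < w (Suc k)" using False by simp
        then have "card (inversions n (w \<circ> sim k)) = Suc (card (inversions n w))"
          by (rule inversions_ascent[OF k])
        moreover have "w \<circ> sim k = word (map fst xs)" by (simp add: w)
        ultimately show False
          using card_inversions_word[OF xs] 2 by simp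
      qed
      then show ?thesis using False 0 by (auto simp: a hecke_def demazure_def word_snoc)
    qed
  }
qed

text \<open>The staircase has as many cells as the longest element has inversions, so a single term
  of the expansion survives.\<close>

lemma coeff_family_reversal: "coeff_family n (reversal n) = grothendieck_longest n"
proof -
  have fst: "map fst (weighted (cells n)) = map snd (cells n)"
    by (auto simp: weighted_def)
  have gens: "set (map fst (weighted (cells n))) \<subseteq> {1..<n}"
    unfolding fst by (auto simp: set_cells)
  have len: "length (weighted (cells n)) = card (inversions n (reversal n))"
    by (simp add: card_inversions_reversal weighted_def)
  have "coeff_family n (reversal n) = prod_list (map snd (weighted (cells n)))"
    unfolding coeff_family_def act_unit_long(2)[OF gens len] fst word_cells by simp
  also have "map snd (weighted (cells n)) = map (\<lambda>(v, k). cell_weight v k) (cells n)"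
    by (auto simp: weighted_def)
  also have "prod_list \<dots> = (\<Prod>(v, k) \<in> set (cells n). cell_weight v k)"
    by (simp add: prod.distinct_set_conv_list distinct_cells)
  also have "\<dots> = grothendieck_longest n"
    unfolding grothendieck_longest_def
    by (rule prod.reindex_bij_witness[where i = "\<lambda>(i, j). (i, i + j - 1)" and j = "\<lambda>(v, k). (v, k + 1 - v)"])
      (auto simp: set_cells cell_weight_def)
  finally show ?thesis .
qed

lemma is_grothendieck_unique: "is_grothendieck n w g \<Longrightarrow> g = coeff_family n w"
proof (induction rule: is_grothendieck.induct)
  case longest
  then show ?case by (simp add: longest_eq_reversal coeff_family_reversal)
next
  case (step w i g)
  have "w i \<noteq> w (Suc i)" by (metis n_not_Suc_n permutes_inj[OF step(1)] inj_eq)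
  moreover have "\<not> w (Suc i) < w i"
    using inversions_descent[OF step(3), of w] step(4) coxeter_length_eq[OF step(1)]
      coxeter_length_eq[OF permutes_comp_sim[OF step(1,3)]] by auto
  ultimately have "w i < w (Suc i)" by simp
  then show ?case
    using divided_difference_coeff_family[of i n w] step by (simp del: comp_apply)
qed

lemma is_grothendieck_exists:
  assumes "w permutes {1..n}"
  shows "is_grothendieck n w (coeff_family n w)"
  using assms
proof (induction "n * n - card (inversions n w)" arbitrary: w rule: less_induct)
  case less
  show ?case
  proof (cases "w = longest n")
    case True
    then show ?thesis
      using is_grothendieck.longest[of n] by (simp add: longest_eq_reversal coeff_family_reversal)
  next
    case False
    then obtain k where k: "k \<in> {1..<n}" "w k < w (Suc k)"
      using no_ascent_imp_reversal[OF less.prems] by (auto simp: longest_eq_reversal)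
    have perm: "w \<circ> sim k permutes {1..n}" by (rule permutes_comp_sim[OF less.prems k(1)])
    have "card (inversions n (w \<circ> sim k)) \<le> card ({1..n} \<times> {1..n})"
      by (intro card_mono) (auto simp: inversions_def)
    then have "n * n - card (inversions n (w \<circ> sim k)) < n * n - card (inversions n w)"
      using inversions_ascent[OF k] by simp
    then have "is_grothendieck n (w \<circ> sim k) (coeff_family n (w \<circ> sim k))"
      using less.hyps perm by blast
    then have "is_grothendieck n w (divided_difference k (coeff_family n (w \<circ> sim k)))"
      using less.prems False k inversions_ascent[OF k] perm
      by (intro is_grothendieck.step) (auto simp: coxeter_length_eq)
    then show ?thesis
      using divided_difference_coeff_family[of k n w] k by simp
  qed
qed

theorem grothendieck_eq_coeff_family:
  assumes "w permutes {1..n}"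
  shows "grothendieck n w = coeff_family n w"
  unfolding grothendieck_def
  by (rule the_equality) (auto intro: is_grothendieck_exists is_grothendieck_unique assms)

section \<open>Skew regions attached to 321-avoiding permutations\<close>

text \<open>
  For a 321-avoiding \<open>u\<close>, the \<open>f r\<close> are positions including all excedances and the \<open>g r\<close> are the
  values of \<open>u\<close> there.  Row \<open>r\<close> of the region has the contents \<open>f r, \<dots>, g r - 1\<close>, where \<open>K\<close> only
  fixes the column numbers.  Rows may become empty (\<open>f r = g r\<close>) when corners are removed, which
  keeps \<open>g\<close>, \<open>K\<close> and the remaining boxes unchanged.
\<close>

definition region :: "nat \<Rightarrow> nat \<Rightarrow> (nat \<Rightarrow> nat) \<Rightarrow> (nat \<Rightarrow> nat) \<Rightarrow> (nat \<times> nat) set" where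
  "region K R f g = {(r, c). 1 \<le> r \<and> r \<le> R \<and> K + r < g r + c \<and> c + f r \<le> K + r}"

text \<open>The usual content with opposite sign, shifted to be the index of the generator belonging
  to the box.\<close>

definition content :: "nat \<Rightarrow> nat \<times> nat \<Rightarrow> nat" where
  "content K = (\<lambda>(r, c). K + r - c)"

text \<open>This presents u as a shuffle of two increasing sequences. The bound
  \<open>g r \<le> K + r\<close> keeps all columns positive, so row r has exactly
  \<open>g r - f r\<close> boxes.\<close>

definition compat ::
  "nat \<Rightarrow> nat \<Rightarrow> nat \<Rightarrow> (nat \<Rightarrow> nat) \<Rightarrow> (nat \<Rightarrow> nat) \<Rightarrow> (nat \<Rightarrow> nat) \<Rightarrow> bool" where
  "compat n K R f g u \<longleftrightarrow> u permutes {1..n} \<and>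
     (\<forall>r \<in> {1..R}. 1 \<le> f r \<and> f r \<le> g r \<and> g r \<le> n \<and> g r \<le> K + r \<and> u (f r) = g r) \<and>
     strict_mono_on {1..R} f \<and> strict_mono_on {1..R} g \<and>
     strict_mono_on ({1..n} - f ` {1..R}) u"

text \<open>For strictly increasing f, a box below the last box of row r would force
  \<open>f (Suc r) = Suc k\<close>; excluding this makes the last box an outer corner.\<close>

definition corner_row :: "nat \<Rightarrow> (nat \<Rightarrow> nat) \<Rightarrow> (nat \<Rightarrow> nat) \<Rightarrow> nat \<Rightarrow> nat \<Rightarrow> bool" where
  "corner_row R f g k r \<longleftrightarrow> r \<in> {1..R} \<and> f r = k \<and> k < g r \<and> Suc k \<notin> f ` {1..R}"

lemma finite_region [simp]: "finite (region K R f g)"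
  by (rule finite_subset[of _ "{1..R} \<times> {0..K + R}"]) (auto simp: region_def)

lemma permutes_no_shrink:
  assumes "w permutes A" "S \<subseteq> A" "w ` S \<subseteq> U" "finite U"
  shows "card S \<le> card U"
  using assms by (metis card_image card_mono inj_on_subset permutes_inj_on)

text \<open>Neither increasing sequence contains a descent, so k and k + 1 belong to different ones.
  By pigeonhole, the wrong order would squeeze k, ..., n into k + 1, ..., n, and an empty row would
  squeeze 1, ..., k + 1 into 1, ..., k.\<close>

lemma compat_descent_imp_corner:
  assumes c: "compat n K R f g u" and k: "k \<in> {1..<n}" and desc: "u (Suc k) < u k"
  shows "\<exists>r. corner_row R f g k r"
proof -
  have u: "u permutes {1..n}"
    and fg: "\<And>r. r \<in> {1..R} \<Longrightarrow> f r \<le> g r \<and> g r \<le> n \<and> u (f r) = g r"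
    and f: "strict_mono_on {1..R} f" and g: "strict_mono_on {1..R} g"
    and m: "strict_mono_on ({1..n} - f ` {1..R}) u"
    using c by (auto simp: compat_def)
  have range: "u p \<in> {1..n}" if "p \<in> {1..n}" for p
    using permutes_in_image[OF u] that by blast
  have mono: "u i \<le> u j" if "i \<le> j" "i \<in> {1..n} - f ` {1..R}" "j \<in> {1..n} - f ` {1..R}" for i j
    using strict_mono_onD[OF m, of i j] that by (cases "i = j") auto
  have k_row: "k \<in> f ` {1..R}"
  proof (rule ccontr)
    assume nk: "k \<notin> f ` {1..R}"
    have "Suc k \<in> f ` {1..R}"
      using mono[of k "Suc k"] nk k desc by fastforce
    then obtain r where r: "r \<in> {1..R}" "f r = Suc k" by force
    have "u ` {k..n} \<subseteq> {Suc k..n}"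
    proof
      fix y assume "y \<in> u ` {k..n}"
      then obtain p where p: "p \<in> {k..n}" "y = u p" by blast
      have "Suc k \<le> u p"
      proof (cases "p \<in> f ` {1..R}")
        case True
        then obtain s where s: "s \<in> {1..R}" "p = f s" by blast
        then show ?thesis using fg[OF s(1)] nk p by (cases "p = k") auto
      next
        case False
        then have "u k \<le> u p" using mono[of k p] p k nk by auto
        then show ?thesis using desc fg[OF r(1)] r by simp
      qed
      then show "y \<in> {Suc k..n}" using p range[of p] k by auto
    qed
    then have "card {k..n} \<le> card {Suc k..n}"
      using k by (intro permutes_no_shrink[OF u]) auto
    then show False using k by (simp add: Suc_diff_le)
  qed
  then obtain r where r: "r \<in> {1..R}" "f r = k" by force
  have nSk: "Suc k \<notin> f ` {1..R}"
  proof
    assume "Suc k \<in> f ` {1..R}"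
    then obtain s where s: "s \<in> {1..R}" "f s = Suc k" by force
    have "r < s"
      using strict_mono_on_leD[OF f s(1) r(1)] r s by force
    then show False
      using strict_mono_onD[OF g r(1) s(1)] fg[OF r(1)] fg[OF s(1)] r s desc by simp
  qed
  have "k < g r"
  proof (rule ccontr)
    assume "\<not> k < g r"
    then have gr: "g r = k" using fg[OF r(1)] r by simp
    have "u ` {1..Suc k} \<subseteq> {1..k}"
    proof
      fix y assume "y \<in> u ` {1..Suc k}"
      then obtain p where p: "p \<in> {1..Suc k}" "y = u p" by blast
      have "u p \<le> k"
      proof (cases "p \<in> f ` {1..R}")
        case True
        then obtain s where s: "s \<in> {1..R}" "p = f s" by blast
        then have "f s \<le> f r" using p nSk r by (cases "p = Suc k") auto
        then have "s \<le> r"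
          using strict_mono_onD[OF f r(1) s(1)] by (cases "r < s") auto
        then show ?thesis
          using strict_mono_on_leD[OF g s(1) r(1)] fg[OF s(1)] s gr by simp
      next
        case False
        then have "u p \<le> u (Suc k)" using mono[of p "Suc k"] p k nSk by auto
        then show ?thesis using desc fg[OF r(1)] r gr by simp
      qed
      then show "y \<in> {1..k}" using p range[of p] k by auto
    qed
    then have "card {1..Suc k} \<le> card {1..k}"
      using k by (intro permutes_no_shrink[OF u]) auto
    then show False by simp
  qed
  then show ?thesis using r nSk by (auto simp: corner_row_def)
qed

text \<open>An ascent would send all positions after k to values above \<open>g r\<close>, and
  \<open>g r > k\<close> leaves too few of those.\<close>

lemma compat_corner_imp_descent:
  assumes c: "compat n K R f g u" and k: "k \<in> {1..<n}" and corner: "corner_row R f g k r"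
  shows "u (Suc k) < u k"
proof (rule ccontr)
  have u: "u permutes {1..n}"
    and fg: "\<And>r. r \<in> {1..R} \<Longrightarrow> u (f r) = g r"
    and f: "strict_mono_on {1..R} f" and g: "strict_mono_on {1..R} g"
    and m: "strict_mono_on ({1..n} - f ` {1..R}) u"
    using c by (auto simp: compat_def)
  have r: "r \<in> {1..R}" "f r = k" "k < g r" "Suc k \<notin> f ` {1..R}" "g r \<le> n"
    using corner c by (auto simp: corner_row_def compat_def)
  assume "\<not> u (Suc k) < u k"
  moreover have "u (Suc k) \<noteq> u k" by (metis n_not_Suc_n permutes_inj[OF u] inj_eq)
  ultimately have gt: "g r < u (Suc k)" using fg[OF r(1)] r by simp
  have "u ` {Suc k..n} \<subseteq> {Suc (g r)..n}"
  proof
    fix y assume "y \<in> u ` {Suc k..n}"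
    then obtain p where p: "p \<in> {Suc k..n}" "y = u p" by blast
    have "g r < u p"
    proof (cases "p \<in> f ` {1..R}")
      case True
      then obtain s where s: "s \<in> {1..R}" "p = f s" by blast
      then have "r < s"
        using strict_mono_on_leD[OF f s(1) r(1)] p r by force
      then show ?thesis using strict_mono_onD[OF g r(1) s(1)] fg[OF s(1)] s by simp
    next
      case False
      then have "u (Suc k) \<le> u p"
        using strict_mono_on_leD[OF m, of "Suc k" p] p r by auto
      then show ?thesis using gt by simp
    qed
    then show "y \<in> {Suc (g r)..n}" using p permutes_in_image[OF u, of p] by auto
  qed
  then have "card {Suc k..n} \<le> card {Suc (g r)..n}"
    using k by (intro permutes_no_shrink[OF u]) auto
  then show False using k r by simp
qed

lemma compat_remove_corner:
  assumes c: "compat n K R f g u" and k: "k \<in> {1..<n}" and corner: "corner_row R f g k r"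
  shows "compat n K R (f(r := Suc k)) g (u \<circ> sim k)"
proof -
  have u: "u permutes {1..n}"
    and fg: "\<And>r. r \<in> {1..R} \<Longrightarrow> 1 \<le> f r \<and> f r \<le> g r \<and> g r \<le> n \<and> g r \<le> K + r \<and> u (f r) = g r"
    and f: "strict_mono_on {1..R} f" and g: "strict_mono_on {1..R} g"
    and m: "strict_mono_on ({1..n} - f ` {1..R}) u"
    using c by (auto simp: compat_def)
  have r: "r \<in> {1..R}" "f r = k" "k < g r" "Suc k \<notin> f ` {1..R}"
    using corner by (auto simp: corner_row_def)
  have ne: "f s \<noteq> k \<and> f s \<noteq> Suc k" if "s \<in> {1..R}" "s \<noteq> r" for s
    using strict_mono_on_eqD[OF f, of s r] that r by force
  let ?f = "f(r := Suc k)"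
  have "strict_mono_on {1..R} ?f"
  proof (rule strict_mono_onI)
    fix s s' assume s: "s \<in> {1..R}" "s' \<in> {1..R}" "s < s'"
    then show "?f s < ?f s'"
      using strict_mono_onD[OF f s] ne[of s] ne[of s'] r by auto
  qed
  moreover have "strict_mono_on ({1..n} - ?f ` {1..R}) (u \<circ> sim k)"
  proof (rule strict_mono_onI)
    fix i j assume ij: "i \<in> {1..n} - ?f ` {1..R}" "j \<in> {1..n} - ?f ` {1..R}" "i < j"
    have compl: "sim k p \<in> {1..n} - f ` {1..R}" if "p \<in> {1..n} - ?f ` {1..R}" for p
    proof -
      have "sim k p \<noteq> f s" if "s \<in> {1..R}" for s
      proof
        assume *: "sim k p = f s"
        have "p = sim k (f s)" using *[symmetric] by simp
        also have "\<dots> = ?f s" using ne[OF that] r by (auto simp: sim_other)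
        finally show False using \<open>p \<in> _\<close> that by blast
      qed
      then show ?thesis using sim_mem[OF k, of p] that by blast
    qed
    \<comment> \<open>\<open>Suc k\<close> is now a row position, so (i, j) is not the one pair
      whose order \<open>sim k\<close> reverses.\<close>
    have "j \<noteq> Suc k" using ij r by fastforce
    then have "sim k i < sim k j" using sim_less[OF ij(3)] by simp
    then show "(u \<circ> sim k) i < (u \<circ> sim k) j"
      using strict_mono_onD[OF m] compl ij by simp
  qed
  moreover have "(u \<circ> sim k) (?f s) = g s" if "s \<in> {1..R}" for s
    using fg[OF that] ne[OF that] r by (auto simp: sim_other)
  ultimately show ?thesis
    using permutes_comp_sim[OF u k] fg g r unfolding compat_def by auto
qed

section \<open>Tableaux and the removal of a cell\<close>

text \<open>Elementwise inequalities, unlike \<open>Max\<close> and \<open>Min\<close>, pass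
  directly to restrictions and to smaller sets of entries.\<close>

definition tableaux :: "(nat \<times> nat) set \<Rightarrow> (nat \<times> nat \<Rightarrow> nat set) \<Rightarrow> (nat \<times> nat \<Rightarrow> nat set) set" where
  "tableaux D A = {T \<in> (\<Pi>\<^sub>E q \<in> D. {S. S \<noteq> {} \<and> S \<subseteq> A q}).
     (\<forall>i j j' a b. (i, j) \<in> D \<and> (i, j') \<in> D \<and> j < j' \<and> a \<in> T (i, j) \<and> b \<in> T (i, j') \<longrightarrow> a \<le> b) \<and>
     (\<forall>i i' j a b. (i, j) \<in> D \<and> (i', j) \<in> D \<and> i < i' \<and> a \<in> T (i, j) \<and> b \<in> T (i', j) \<longrightarrow> a < b)}"

definition allowed :: "nat \<Rightarrow> (nat \<times> nat) set \<Rightarrow> nat \<times> nat \<Rightarrow> nat set" where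
  "allowed K C q = {v. (v, content K q) \<in> C}"

text \<open>The exponent of \<beta> is distributed over the boxes, so that a box can be removed
  together with its factor.\<close>

definition box_weight :: "nat \<Rightarrow> nat \<times> nat \<Rightarrow> nat set \<Rightarrow> pol" where
  "box_weight K q S = \<beta> ^ (card S - 1) * (\<Prod>v \<in> S. cell_weight v (content K q))"

lemma finite_allowed: "finite C \<Longrightarrow> finite (allowed K C q)"
  by (rule finite_subset[of _ "fst ` C"]) (force simp: allowed_def)+

lemma tableauxD:
  assumes "T \<in> tableaux D A"
  shows "q \<in> D \<Longrightarrow> T q \<noteq> {}" "q \<in> D \<Longrightarrow> v \<in> T q \<Longrightarrow> v \<in> A q" "q \<notin> D \<Longrightarrow> T q = undefined"
    and "(i, j) \<in> D \<Longrightarrow> (i, j') \<in> D \<Longrightarrow> j < j' \<Longrightarrow> a \<in> T (i, j) \<Longrightarrow> b \<in> T (i, j') \<Longrightarrow> a \<le> b"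
    and "(i, j) \<in> D \<Longrightarrow> (i', j) \<in> D \<Longrightarrow> i < i' \<Longrightarrow> a \<in> T (i, j) \<Longrightarrow> b \<in> T (i', j) \<Longrightarrow> a < b"
proof -
  have T: "T \<in> (\<Pi>\<^sub>E q \<in> D. {S. S \<noteq> {} \<and> S \<subseteq> A q})"
    using assms by (simp add: tableaux_def)
  show "q \<in> D \<Longrightarrow> T q \<noteq> {}" "q \<in> D \<Longrightarrow> v \<in> T q \<Longrightarrow> v \<in> A q"
    using PiE_mem[OF T, of q] by auto
  show "q \<notin> D \<Longrightarrow> T q = undefined"
    by (rule PiE_arb[OF T])
qed (use assms in \<open>unfold tableaux_def, blast\<close>)+

lemma tableauxI:
  assumes "\<And>q. q \<in> D \<Longrightarrow> T q \<noteq> {}" "\<And>q v. q \<in> D \<Longrightarrow> v \<in> T q \<Longrightarrow> v \<in> A q"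
    "\<And>q. q \<notin> D \<Longrightarrow> T q = undefined"
    and "\<And>i j j' a b. (i, j) \<in> D \<Longrightarrow> (i, j') \<in> D \<Longrightarrow> j < j' \<Longrightarrow> a \<in> T (i, j) \<Longrightarrow> b \<in> T (i, j') \<Longrightarrow> a \<le> b"
    and "\<And>i i' j a b. (i, j) \<in> D \<Longrightarrow> (i', j) \<in> D \<Longrightarrow> i < i' \<Longrightarrow> a \<in> T (i, j) \<Longrightarrow> b \<in> T (i', j) \<Longrightarrow> a < b"
  shows "T \<in> tableaux D A"
  unfolding tableaux_def using assms by (intro CollectI conjI PiE_I) blast+

lemma finite_tableaux:
  assumes "finite D" "\<And>q. finite (A q)"
  shows "finite (tableaux D A)"
proof (rule finite_subset)
  have "(\<Pi>\<^sub>E q \<in> D. {S. S \<noteq> {} \<and> S \<subseteq> A q}) \<subseteq> (\<Pi>\<^sub>E q \<in> D. Pow (A q))"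
    by (rule PiE_mono) blast
  then show "tableaux D A \<subseteq> (\<Pi>\<^sub>E q \<in> D. Pow (A q))"
    unfolding tableaux_def by blast
  show "finite (\<Pi>\<^sub>E q \<in> D. Pow (A q))"
    using assms by (intro finite_PiE) simp_all
qed

lemma box_weight_insert:
  assumes "finite S" "S \<noteq> {}" "i \<notin> S"
  shows "box_weight K q (insert i S) = \<beta> * cell_weight i (content K q) * box_weight K q S"
proof -
  obtain m where "card S = Suc m" using assms by (metis card_eq_0_iff not0_implies_Suc)
  then show ?thesis using assms by (simp add: box_weight_def algebra_simps)
qed

text \<open>
  The cell \<open>(i, k)\<close> is last in the reading order, so all other entries of content \<open>k - 1\<close>
  (to the right or above) are smaller than \<open>i\<close> and all those of content \<open>k + 1\<close> are at most \<open>i\<close>.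
  Hence \<open>i\<close> can only sit in an outer corner, and may be added there freely.
\<close>

lemma last_entry_in_corner:
  assumes c: "compat n K R f g u" and k: "k \<in> {1..<n}"
    and last: "\<And>p. p \<in> C \<Longrightarrow> cell_less p (i, k)"
    and T: "T \<in> tableaux (region K R f g) (allowed K (insert (i, k) C))"
    and q: "q \<in> region K R f g" "content K q = k" "i \<in> T q"
  shows "\<exists>r. corner_row R f g k r \<and> q = (r, K + r - k)"
proof -
  let ?D = "region K R f g"
  have f: "strict_mono_on {1..R} f" and g: "strict_mono_on {1..R} g"
    using c by (auto simp: compat_def)
  obtain r c where rc: "q = (r, c)" by fastforce
  have D: "1 \<le> r" "r \<le> R" "K + r < g r + c" "c + f r \<le> K + r" and kc: "K + r - c = k"
    using q by (auto simp: rc region_def content_def)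
  have ent: "v < i \<or> v = i \<and> k \<le> content K p" if "p \<in> ?D" "v \<in> T p" for p v
    using tableauxD(2)[OF T that] last[of "(v, content K p)"]
    by (auto simp: allowed_def cell_less_def)
  have "(r, Suc c) \<notin> ?D"
  proof
    assume right: "(r, Suc c) \<in> ?D"
    then obtain v where v: "v \<in> T (r, Suc c)" using tableauxD(1)[OF T] by blast
    have "i \<le> v" using tableauxD(4)[OF T _ right _ _ v, of c i] q by (auto simp: rc)
    then show False using ent[OF right v] kc k by (auto simp: content_def)
  qed
  then have fr: "f r = k" using D kc by (auto simp: region_def)
  have "(Suc r, c) \<notin> ?D"
  proof
    assume below: "(Suc r, c) \<in> ?D"
    then obtain v where v: "v \<in> T (Suc r, c)" using tableauxD(1)[OF T] by blast
    have "i < v" using tableauxD(5)[OF T _ below _ _ v, of r i] q by (auto simp: rc)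
    then show False using ent[OF below v] by auto
  qed
  moreover have "g r < g (Suc r)" if "Suc r \<le> R"
    using strict_mono_onD[OF g, of r "Suc r"] that D by auto
  ultimately have f_Suc: "Suc k < f (Suc r)" if "Suc r \<le> R"
    using that D kc fr by (force simp: region_def)
  have "Suc k \<notin> f ` {1..R}"
  proof
    assume "Suc k \<in> f ` {1..R}"
    then obtain s where s: "s \<in> {1..R}" "f s = Suc k" by force
    have "r < s" using strict_mono_on_leD[OF f s(1), of r] D s fr by force
    then have "f (Suc r) \<le> f s" using strict_mono_on_leD[OF f _ s(1), of "Suc r"] s by auto
    then show False using f_Suc \<open>r < s\<close> s by auto
  qed
  then show ?thesis using D kc fr by (auto simp: corner_row_def rc)
qed

lemma tableaux_mono: "(\<And>q. q \<in> D \<Longrightarrow> A q \<subseteq> A' q) \<Longrightarrow> tableaux D A \<subseteq> tableaux D A'"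
  by (fastforce simp: tableaux_def PiE_iff)

lemma region_remove_corner:
  assumes c: "compat n K R f g u" and corner: "corner_row R f g k r"
  shows "region K R f g = insert (r, K + r - k) (region K R (f(r := Suc k)) g)"
    and "(r, K + r - k) \<notin> region K R (f(r := Suc k)) g"
    and "content K (r, K + r - k) = k"
proof -
  have r: "r \<in> {1..R}" "f r = k" "k < g r" "g r \<le> K + r"
    using c corner by (auto simp: compat_def corner_row_def)
  then show "region K R f g = insert (r, K + r - k) (region K R (f(r := Suc k)) g)"
    by (auto simp: region_def split: if_splits)
  show "(r, K + r - k) \<notin> region K R (f(r := Suc k)) g" "content K (r, K + r - k) = k"
    using r by (auto simp: region_def content_def)
qed

text \<open>Below row r the values of f rise strictly and skip k + 1, so all lower rows end to the
  left of the corner.\<close>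

lemma corner_outermost:
  assumes c: "compat n K R f g u" and corner: "corner_row R f g k r"
  shows "K + r - k < c' \<Longrightarrow> (r, c') \<notin> region K R f g"
    and "r < r' \<Longrightarrow> (r', K + r - k) \<notin> region K R f g"
proof -
  have f: "strict_mono_on {1..R} f" using c by (auto simp: compat_def)
  have r: "r \<in> {1..R}" "f r = k" "k < g r" "g r \<le> K + r" "Suc k \<notin> f ` {1..R}"
    using c corner by (auto simp: compat_def corner_row_def)
  show "K + r - k < c' \<Longrightarrow> (r, c') \<notin> region K R f g"
    using r by (auto simp: region_def)
  have "k + Suc (s - r) \<le> f s" if "Suc r \<le> s" "s \<le> R" for s
    using that
  proof (induction s rule: dec_induct)
    case base
    have "f r < f (Suc r)" using strict_mono_onD[OF f, of r "Suc r"] r base by auto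
    moreover have "f (Suc r) \<noteq> Suc k" using r base by (metis atLeastAtMost_iff image_eqI le_SucI)
    ultimately show ?case using r by simp
  next
    case (step s)
    have "f s < f (Suc s)" using strict_mono_onD[OF f, of s "Suc s"] step by auto
    then show ?case using step by auto
  qed
  from this[of r'] show "r < r' \<Longrightarrow> (r', K + r - k) \<notin> region K R f g"
    using r by (auto simp: region_def)
qed

text \<open>The new entry is absent, or fills the corner alone and disappears with its box, or
  shares the corner and costs a factor \<beta>. These three cases mirror \<open>hecke\<close> at a
  descent.\<close>

lemma tableaux_sum_step:
  assumes c: "compat n K R f g u" and k: "k \<in> {1..<n}" and "finite C"
    and last: "\<And>p. p \<in> C \<Longrightarrow> cell_less p (i, k)"
    and corner: "corner_row R f g k r"
  defines "D \<equiv> region K R f g" and "D' \<equiv> region K R (f(r := Suc k)) g"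
    and "A \<equiv> allowed K C" and "A' \<equiv> allowed K (insert (i, k) C)"
    and "wt \<equiv> \<lambda>D T. \<Prod>q \<in> D. box_weight K q (T q)"
  shows "(\<Sum>T \<in> tableaux D A'. wt D T) = (\<Sum>T \<in> tableaux D A. wt D T)
     + cell_weight i k * ((\<Sum>T \<in> tableaux D' A. wt D' T) + \<beta> * (\<Sum>T \<in> tableaux D A. wt D T))"
proof -
  define q where "q = (r, K + r - k)"
  have D: "D = insert q D'" "q \<notin> D'" "content K q = k" "finite D'"
    using region_remove_corner[OF c corner] by (simp_all add: D_def D'_def q_def)
  have qD: "q \<in> D" by (simp add: D)
  have out: "(r, c') \<notin> D" if "K + r - k < c'" for c'
    using corner_outermost(1)[OF c corner that] by (simp add: D_def)
  have out': "(r', K + r - k) \<notin> D" if "r < r'" for r'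
    using corner_outermost(2)[OF c corner that] by (simp add: D_def)
  have nC: "(i, k) \<notin> C" using last by (force simp: cell_less_def)
  have A': "A' p = (if content K p = k then insert i (A p) else A p)" for p
    by (auto simp: A_def A'_def allowed_def)
  have iA: "i \<notin> A q" using nC D by (auto simp: A_def allowed_def)
  have Ale: "v \<le> i" if "v \<in> A p" for v p
    using that last by (force simp: A_def allowed_def cell_less_def)
  \<comment> \<open>The cell (i, k') with k' < k is read after (i, k), so i itself is not yet
    allowed at content k'. This gives the strictness needed in columns.\<close>
  have Aless: "v < i" if "v \<in> A p" "content K p < k" for v p
    using that last by (force simp: A_def allowed_def cell_less_def)
  have finA: "finite (A p)" "finite (A' p)" for p
    using \<open>finite C\<close> by (simp_all add: A_def A'_def finite_allowed)
  have fin: "finite (tableaux D A')" "finite (tableaux D A)" "finite (tableaux D' A)"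
    using finA D by (simp_all add: finite_tableaux)
  \<comment> \<open>Since f is injective, there is only one corner of content k.\<close>
  have only_q: "p = q" if T: "T \<in> tableaux D A'" and p: "p \<in> D" "content K p = k" "i \<in> T p" for T p
  proof -
    obtain s where s: "corner_row R f g k s" "p = (s, K + s - k)"
      using last_entry_in_corner[OF c k last, of C T p] T p
      unfolding D_def A'_def by blast
    have "s = r"
      using s(1) corner c strict_mono_on_eqD[of "{1..R}" f s r] by (auto simp: corner_row_def compat_def)
    then show ?thesis using s by (simp add: q_def)
  qed
  have inA: "v \<in> A p" if T: "T \<in> tableaux D A'" and p: "p \<in> D" "v \<in> T p" "p \<noteq> q \<or> v \<noteq> i" for T p v
    using tableauxD(2)[OF T p(1,2)] only_q[OF T p(1)] p by (auto simp: A' split: if_splits)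
  have above: "content K (r', K + r - k) < k" if "(r', K + r - k) \<in> D" "r' < r" for r'
    using that D(3) by (auto simp: content_def q_def D_def region_def)
  have new: "T(q := S) \<in> tableaux D A'"
    if T: "T \<in> tableaux D' A" and S: "i \<in> S" "S \<subseteq> insert i (A q)"
      and left: "\<And>c' a b. (r, c') \<in> D' \<Longrightarrow> a \<in> T (r, c') \<Longrightarrow> b \<in> S \<Longrightarrow> a \<le> b"
      and top: "\<And>r' a b. (r', K + r - k) \<in> D' \<Longrightarrow> a \<in> T (r', K + r - k) \<Longrightarrow> b \<in> S \<Longrightarrow> a < b"
    for T S
  proof (rule tableauxI)
    fix p assume "p \<in> D"
    then show "(T(q := S)) p \<noteq> {}" using tableauxD(1)[OF T, of p] S D by (cases "p = q") auto
  next
    fix p v assume "p \<in> D" "v \<in> (T(q := S)) p"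
    then show "v \<in> A' p" using tableauxD(2)[OF T, of p v] S D by (auto simp: A' split: if_splits)
  next
    fix p assume "p \<notin> D"
    then show "(T(q := S)) p = undefined" using tableauxD(3)[OF T, of p] D by auto
  next
    fix s j j' a b
    assume *: "(s, j) \<in> D" "(s, j') \<in> D" "j < j'" "a \<in> (T(q := S)) (s, j)" "b \<in> (T(q := S)) (s, j')"
    then have "(s, j) \<noteq> q" using out by (auto simp: q_def)
    then have 1: "(s, j) \<in> D'" "a \<in> T (s, j)" using * D by auto
    show "a \<le> b"
    proof (cases "(s, j') = q")
      case True
      then show ?thesis using left[of j a b] 1 * by (auto simp: q_def)
    next
      case False
      then show ?thesis using tableauxD(4)[OF T 1(1) _ *(3) 1(2), of b] * D by auto
    qed
  next
    fix s s' j a b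
    assume *: "(s, j) \<in> D" "(s', j) \<in> D" "s < s'" "a \<in> (T(q := S)) (s, j)" "b \<in> (T(q := S)) (s', j)"
    then have "(s, j) \<noteq> q" using out' by (auto simp: q_def)
    then have 1: "(s, j) \<in> D'" "a \<in> T (s, j)" using * D by auto
    show "a < b"
    proof (cases "(s', j) = q")
      case True
      then show ?thesis using top[of s a b] 1 * by (auto simp: q_def)
    next
      case False
      then show ?thesis using tableauxD(5)[OF T 1(1) _ *(3) 1(2), of b] * D by auto
    qed
  qed
  have restr: "restrict T D' \<in> tableaux D' A" if T: "T \<in> tableaux D A'" for T
  proof (rule tableauxI)
    fix p v assume p: "p \<in> D'" "v \<in> restrict T D' p"
    then show "v \<in> A p" using inA[OF T, of p v] D by auto
  next
    fix s j j' a b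
    assume "(s, j) \<in> D'" "(s, j') \<in> D'" "j < j'" "a \<in> restrict T D' (s, j)" "b \<in> restrict T D' (s, j')"
    then show "a \<le> b" using tableauxD(4)[OF T, of s j j' a b] D by auto
  next
    fix s s' j a b
    assume "(s, j) \<in> D'" "(s', j) \<in> D'" "s < s'" "a \<in> restrict T D' (s, j)" "b \<in> restrict T D' (s', j)"
    then show "a < b" using tableauxD(5)[OF T, of s j s' a b] D by auto
  qed (use D tableauxD(1)[OF T] in auto)
  have sub: "tableaux D A \<subseteq> tableaux D A'"
    by (rule tableaux_mono) (auto simp: A')
  have restr': "restrict T D' \<in> tableaux D' A" if "T \<in> tableaux D A" for T
    using restr that sub by blast
  define R1 where "R1 = {T \<in> tableaux D A'. T q = {i}}"
  define R2 where "R2 = {T \<in> tableaux D A'. i \<in> T q \<and> T q \<noteq> {i}}"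
  have split: "tableaux D A' = tableaux D A \<union> (R1 \<union> R2)"
  proof (intro equalityI subsetI)
    fix T assume T: "T \<in> tableaux D A'"
    show "T \<in> tableaux D A \<union> (R1 \<union> R2)"
    proof (cases "i \<in> T q")
      case False
      have "T \<in> tableaux D A"
      proof (rule tableauxI)
        fix p v assume "p \<in> D" "v \<in> T p"
        then show "v \<in> A p" using inA[OF T, of p v] False by blast
      next
        fix s j j' a b
        assume "(s, j) \<in> D" "(s, j') \<in> D" "j < j'" "a \<in> T (s, j)" "b \<in> T (s, j')"
        then show "a \<le> b" by (rule tableauxD(4)[OF T])
      next
        fix s s' j a b
        assume "(s, j) \<in> D" "(s', j) \<in> D" "s < s'" "a \<in> T (s, j)" "b \<in> T (s', j)"
        then show "a < b" by (rule tableauxD(5)[OF T])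
      qed (fact tableauxD(1,3)[OF T])+
      then show ?thesis by simp
    qed (use T in \<open>auto simp: R1_def R2_def\<close>)
  next
    fix T assume "T \<in> tableaux D A \<union> (R1 \<union> R2)"
    then show "T \<in> tableaux D A'"
      using sub by (auto simp: R1_def R2_def)
  qed
  have disj: "tableaux D A \<inter> (R1 \<union> R2) = {}" "R1 \<inter> R2 = {}"
    using iA qD tableauxD(2)[of _ D A q i] by (auto simp: R1_def R2_def)
  have finR: "finite R1" "finite R2" using fin by (auto simp: R1_def R2_def)
  have wt_D: "wt D T = box_weight K q (T q) * wt D' T" for T
    using D by (simp add: wt_def)
  have wt_cong: "wt D' T = wt D' T'" if "\<And>p. p \<in> D' \<Longrightarrow> T p = T' p" for T T'
    using that by (simp add: wt_def)
  have "(\<Sum>T \<in> R1. wt D T) = (\<Sum>T \<in> tableaux D' A. cell_weight i k * wt D' T)"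
  proof (rule sum.reindex_bij_witness[where i = "\<lambda>T. T(q := {i})" and j = "\<lambda>T. restrict T D'"])
    fix T assume T: "T \<in> R1"
    then show "restrict T D' \<in> tableaux D' A" using restr by (auto simp: R1_def)
    show "(restrict T D')(q := {i}) = T"
      using T D tableauxD(3)[of T D A'] by (auto simp: fun_eq_iff R1_def)
    have "wt D' (restrict T D') = wt D' T" by (rule wt_cong) simp
    then show "cell_weight i k * wt D' (restrict T D') = wt D T"
      using T D(3) by (simp add: wt_D R1_def box_weight_def)
  next
    fix T assume T: "T \<in> tableaux D' A"
    show "restrict (T(q := {i})) D' = T"
      using D tableauxD(3)[OF T] by (auto simp: fun_eq_iff)
    have "T(q := {i}) \<in> tableaux D A'"
    proof (rule new[OF T])
      fix r' a b assume *: "(r', K + r - k) \<in> D'" "a \<in> T (r', K + r - k)" "b \<in> {i}"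
      then have "r' < r" using out'[of r'] D by (cases r r' rule: linorder_cases) (auto simp: q_def)
      then have "content K (r', K + r - k) < k" using above * D(1) by blast
      then show "a < b" using Aless tableauxD(2)[OF T *(1,2)] *(3) by blast
    next
      fix c' a b assume *: "(r, c') \<in> D'" "a \<in> T (r, c')" "b \<in> {i}"
      then show "a \<le> b" using Ale tableauxD(2)[OF T *(1,2)] by blast
    qed simp_all
    then show "T(q := {i}) \<in> R1" by (simp add: R1_def)
  qed
  moreover have "(\<Sum>T \<in> R2. wt D T) = (\<Sum>T \<in> tableaux D A. \<beta> * cell_weight i k * wt D T)"
  proof (rule sum.reindex_bij_witness[where i = "\<lambda>T. T(q := insert i (T q))" and j = "\<lambda>T. T(q := T q - {i})"])
    fix T assume T: "T \<in> R2"
    then have T': "T \<in> tableaux D A'" "i \<in> T q" "T q \<noteq> {i}" by (auto simp: R2_def)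
    let ?T = "T(q := T q - {i})"
    show "?T(q := insert i (?T q)) = T"
      using T'(2) by (simp add: insert_absorb)
    have "v \<in> T p \<and> (p \<noteq> q \<or> v \<noteq> i)" if "v \<in> ?T p" for v p
      using that by (simp split: if_splits)
    then have sub: "\<And>v p. v \<in> ?T p \<Longrightarrow> v \<in> T p" "\<And>v p. v \<in> ?T p \<Longrightarrow> p \<noteq> q \<or> v \<noteq> i"
      by blast+
    show "?T \<in> tableaux D A"
    proof (rule tableauxI)
      fix p assume "p \<in> D"
      then have "T p \<noteq> {}" by (rule tableauxD(1)[OF T'(1)])
      then show "?T p \<noteq> {}" using T'(2,3) by (cases "p = q") auto
    next
      fix p v assume "p \<in> D" "v \<in> ?T p"
      then show "v \<in> A p" using inA[OF T'(1)] sub by blast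
    next
      fix p assume p: "p \<notin> D"
      then have "p \<noteq> q" using qD by blast
      then show "?T p = undefined" using tableauxD(3)[OF T'(1) p] by simp
    next
      fix s j j' a b
      assume *: "(s, j) \<in> D" "(s, j') \<in> D" "j < j'" "a \<in> ?T (s, j)" "b \<in> ?T (s, j')"
      show "a \<le> b"
        by (rule tableauxD(4)[OF T'(1) *(1-3) sub(1)[OF *(4)] sub(1)[OF *(5)]])
    next
      fix s s' j a b
      assume *: "(s, j) \<in> D" "(s', j) \<in> D" "s < s'" "a \<in> ?T (s, j)" "b \<in> ?T (s', j)"
      show "a < b"
        by (rule tableauxD(5)[OF T'(1) *(1-3) sub(1)[OF *(4)] sub(1)[OF *(5)]])
    qed
    have "finite (T q)"
      using finA(2)[of q] tableauxD(2)[OF T'(1) qD] by (meson finite_subset subsetI)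
    then have "box_weight K q (insert i (T q - {i})) = \<beta> * cell_weight i k * box_weight K q (T q - {i})"
      using T'(2,3) D(3) by (subst box_weight_insert) auto
    moreover have "wt D' ?T = wt D' T" by (rule wt_cong) (use D(2) in auto)
    ultimately show "\<beta> * cell_weight i k * wt D ?T = wt D T"
      using T'(2) by (simp add: wt_D insert_absorb mult.assoc)
  next
    fix T assume T: "T \<in> tableaux D A"
    have "i \<notin> T q" using tableauxD(2)[OF T qD] iA by auto
    then show "(T(q := insert i (T q)))(q := (T(q := insert i (T q))) q - {i}) = T" by auto
    have "(restrict T D')(q := insert i (T q)) \<in> tableaux D A'"
    proof (rule new[OF restr'[OF T]])
      fix c' a b assume *: "(r, c') \<in> D'" "a \<in> restrict T D' (r, c')" "b \<in> insert i (T q)"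
      have 1: "(r, c') \<in> D" "(r, c') \<noteq> q" "a \<in> T (r, c')" using * D(1,2) by auto
      then have "c' < K + r - k"
        using out[of c'] by (cases c' "K + r - k" rule: linorder_cases) (auto simp: q_def)
      then have "a \<le> b" if "b \<in> T q"
        using tableauxD(4)[OF T 1(1) qD[unfolded q_def] _ 1(3)] that by (simp add: q_def)
      then show "a \<le> b" using *(3) Ale tableauxD(2)[OF T 1(1,3)] by blast
    next
      fix r' a b
      assume *: "(r', K + r - k) \<in> D'" "a \<in> restrict T D' (r', K + r - k)" "b \<in> insert i (T q)"
      have 1: "(r', K + r - k) \<in> D" "(r', K + r - k) \<noteq> q" "a \<in> T (r', K + r - k)"
        using * D(1,2) by auto
      then have "r' < r"
        using out'[of r'] by (cases r r' rule: linorder_cases) (auto simp: q_def)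
      then have "a < b" if "b \<in> T q"
        using tableauxD(5)[OF T 1(1) qD[unfolded q_def] _ 1(3)] that by (simp add: q_def)
      moreover have "a < i" using Aless tableauxD(2)[OF T 1(1,3)] above[OF 1(1) \<open>r' < r\<close>] by blast
      ultimately show "a < b" using *(3) by blast
    next
      show "insert i (T q) \<subseteq> insert i (A q)" using tableauxD(2)[OF T qD] by blast
    qed simp
    moreover have "(restrict T D')(q := insert i (T q)) = T(q := insert i (T q))"
      using D(1) tableauxD(3)[OF T] by (auto simp: fun_eq_iff)
    ultimately show "T(q := insert i (T q)) \<in> R2"
      using \<open>i \<notin> T q\<close> tableauxD(1)[OF T qD] by (auto simp: R2_def)
  qed
  moreover have "(\<Sum>T \<in> tableaux D A'. wt D T)
      = (\<Sum>T \<in> tableaux D A. wt D T) + ((\<Sum>T \<in> R1. wt D T) + (\<Sum>T \<in> R2. wt D T))"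
    unfolding split using fin(2) finR disj by (simp add: sum.union_disjoint)
  ultimately show ?thesis
    by (simp add: sum_distrib_left[symmetric] algebra_simps)
qed

text \<open>A nonidentity u has a descent, hence a corner; for the identity all rows have
  \<open>f r = g r\<close>.\<close>

lemma compat_id_iff_region_empty:
  assumes c: "compat n K R f g u"
  shows "u = id \<longleftrightarrow> region K R f g = {}"
proof
  assume "u = id"
  then have "f r = g r" if "r \<in> {1..R}" for r
    using c that by (auto simp: compat_def)
  then show "region K R f g = {}" by (fastforce simp: region_def)
next
  assume empty: "region K R f g = {}"
  have u: "u permutes {1..n}" using c by (simp add: compat_def)
  show "u = id"
  proof (rule no_descent_imp_id[OF u], rule ccontr)
    fix k assume k: "k \<in> {1..<n}" and "\<not> u k < u (Suc k)"
    moreover have "u k \<noteq> u (Suc k)" by (metis n_not_Suc_n permutes_inj[OF u] inj_eq)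
    ultimately obtain r where "corner_row R f g k r"
      using compat_descent_imp_corner[OF c k] by force
    then show False using region_remove_corner(1)[OF c] empty by blast
  qed
qed

theorem act_eq_tableaux_sum:
  assumes "sorted_wrt cell_less cs" "snd ` set cs \<subseteq> {1..<n}" "compat n K R f g u"
  shows "act (weighted cs) unit_family u
    = (\<Sum>T \<in> tableaux (region K R f g) (allowed K (set cs)).
        \<Prod>q \<in> region K R f g. box_weight K q (T q))"
  using assms
proof (induction cs arbitrary: f u rule: rev_induct)
  case Nil
  show ?case
  proof (cases "region K R f g = {}")
    case True
    then have "u = id" using compat_id_iff_region_empty[OF Nil(3)] by simp
    moreover have "tableaux {} A = {\<lambda>_. undefined}" for A
      by (auto simp: tableaux_def)
    ultimately show ?thesis using True by (simp add: weighted_def unit_family_def id_def)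
  next
    case False
    \<comment> \<open>Without cells no entry is allowed, but every box needs one.\<close>
    then have "tableaux (region K R f g) (allowed K (set [])) = {}"
      using tableauxD(1,2) by (fastforce simp: allowed_def)
    then show ?thesis
      using False compat_id_iff_region_empty[OF Nil(3)] by (simp add: weighted_def unit_family_def)
  qed
next
  case (snoc p cs)
  obtain i k where p: "p = (i, k)" by fastforce
  have k: "k \<in> {1..<n}" and cs: "sorted_wrt cell_less cs" "snd ` set cs \<subseteq> {1..<n}"
    and last: "\<And>p. p \<in> set cs \<Longrightarrow> cell_less p (i, k)"
    using snoc.prems by (auto simp: p sorted_wrt_append)
  note c = snoc.prems(3)
  note IH = snoc.IH[OF cs]
  have step: "act (weighted (cs @ [p])) unit_family u
     = act (weighted cs) unit_family u + cell_weight i k * demazure k (act (weighted cs) unit_family) u"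
    by (simp add: weighted_def p hecke_def)
  show ?case
  proof (cases "u (Suc k) < u k")
    case True
    then obtain r where r: "corner_row R f g k r"
      using compat_descent_imp_corner[OF c k] by blast
    have "set (cs @ [p]) = insert (i, k) (set cs)" by (simp add: p)
    then show ?thesis
      using True
      unfolding step demazure_def IH[OF c] IH[OF compat_remove_corner[OF c k r]]
      by (simp only: tableaux_sum_step[OF c k finite_set[of cs] last r] if_True)
  next
    case False
    let ?D = "region K R f g" and ?A = "allowed K (set cs)" and ?A' = "allowed K (insert (i, k) (set cs))"
    have "T \<in> tableaux ?D ?A" if T: "T \<in> tableaux ?D ?A'" for T
    proof (rule tableauxI)
      fix q v assume q: "q \<in> ?D" "v \<in> T q"
      \<comment> \<open>Such an entry would sit in a corner of content k and so produce a descent at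
        k.\<close>
      have "\<not> (content K q = k \<and> v = i)"
        using last_entry_in_corner[OF c k last, of "set cs" T q] T q False
          compat_corner_imp_descent[OF c k] by blast
      then show "v \<in> ?A q" using tableauxD(2)[OF T q] by (auto simp: allowed_def)
    qed (use tableauxD[OF T] in blast)+
    moreover have "tableaux ?D ?A \<subseteq> tableaux ?D ?A'"
      by (rule tableaux_mono) (auto simp: allowed_def)
    ultimately have "tableaux ?D ?A' = tableaux ?D ?A" by blast
    moreover have "set (cs @ [p]) = insert (i, k) (set cs)" by (simp add: p)
    ultimately show ?thesis
      using False unfolding step demazure_def IH[OF c] by simp
  qed
qed

section \<open>The shape of a 321-avoiding permutation\<close>

text \<open>If w i > w j, some earlier position must exceed w i, giving the pattern 321: otherwise
  1, ..., i and j would all map into 1, ..., w i, which is too small because w i \<le> i.\<close>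

lemma nonexcedance_values_less:
  assumes w: "w permutes {1..n}" and avoid: "avoids_321 n w"
    and i: "i \<in> {1..n} - excedances n w" and j: "j \<in> {1..n} - excedances n w" and "i < j"
  shows "w i < w j"
proof (rule ccontr)
  assume "\<not> w i < w j"
  moreover have neq: "w p \<noteq> w q" if "p \<noteq> q" for p q
    using permutes_inj[OF w] that by (simp add: inj_eq)
  ultimately have ji: "w j < w i" using \<open>i < j\<close> by (metis less_linear nat_neq_iff)
  have "\<exists>k. 1 \<le> k \<and> k < i \<and> w i < w k"
  proof (rule ccontr)
    assume none: "\<not> (\<exists>k. 1 \<le> k \<and> k < i \<and> w i < w k)"
    have "w ` insert j {1..i} \<subseteq> {1..w i}"
    proof
      fix y assume "y \<in> w ` insert j {1..i}"
      then obtain p where p: "p = j \<or> p \<in> {1..i}" "y = w p" by blast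
      then have "p \<in> {1..n}" using i j by auto
      then have "w p \<in> {1..n}" using permutes_in_image[OF w, of p] by blast
      moreover have "w p \<le> w i"
        using p ji none by (cases "p = j \<or> p = i") (auto simp: not_less)
      ultimately show "y \<in> {1..w i}" using p by auto
    qed
    then have "card (insert j {1..i}) \<le> card {1..w i}"
      using i j by (intro permutes_no_shrink[OF w]) auto
    then show False using i \<open>i < j\<close> by (auto simp: excedances_def)
  qed
  then show False
    using avoid \<open>i < j\<close> ji j unfolding avoids_321_def by auto
qed

lemma flag_image: "flag n w ` {1..num_rows n w} = excedances n w"
proof
  show "flag n w ` {1..num_rows n w} \<subseteq> excedances n w"
    using flag_mem by blast
  show "excedances n w \<subseteq> flag n w ` {1..num_rows n w}"
  proof
    fix e assume "e \<in> excedances n w"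
    moreover have "finite (excedances n w)" by (simp add: excedances_def)
    ultimately obtain m where "m < num_rows n w" "sorted_list_of_set (excedances n w) ! m = e"
      by (metis in_set_conv_nth length_sorted_list_of_set num_rows_def set_sorted_list_of_set)
    then show "e \<in> flag n w ` {1..num_rows n w}"
      by (intro image_eqI[of _ _ "Suc m"]) (auto simp: flag_def)
  qed
qed

text \<open>For every row r of the shape, \<open>base\<close> is \<lambda>(r) + f(r) - r. The
  content of a box (r, c) is thus \<lambda>(r) + f(r) - c, as in the index of b.\<close>

definition base :: "nat \<Rightarrow> (nat \<Rightarrow> nat) \<Rightarrow> nat" where
  "base n w = outer_shape n w 1 + flag n w 1 - 1"

context
  fixes n :: nat and w :: "nat \<Rightarrow> nat"
  assumes w: "w permutes {1..n}" and avoid: "avoids_321 n w"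
begin

lemma shape_base:
  assumes r: "r \<in> {1..num_rows n w}"
  shows "outer_shape n w r + flag n w r = base n w + r"
    and "inner_shape n w r + w (flag n w r) = base n w + r"
proof -
  have one: "1 \<in> {1..num_rows n w}" using r by auto
  have "1 \<le> flag n w 1" using flag_mem[OF one] by (auto simp: excedances_def)
  then show "outer_shape n w r + flag n w r = base n w + r"
    "inner_shape n w r + w (flag n w r) = base n w + r"
    using outer_inner_shape[OF w avoid r] outer_inner_shape[OF w avoid one]
    unfolding base_def by linarith+
qed

lemma sigma_shape_eq_region:
  "sigma_shape n w = region (base n w) (num_rows n w) (flag n w) (w \<circ> flag n w)"
proof -
  have "inner_shape n w r < c \<and> c \<le> outer_shape n w r
      \<longleftrightarrow> base n w + r < w (flag n w r) + c \<and> c + flag n w r \<le> base n w + r"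
    if "1 \<le> r" "r \<le> num_rows n w" for r c
    using shape_base[of r] that by auto
  then show ?thesis by (auto simp: sigma_shape_def boxes_def region_def)
qed

lemma compat_permutation:
  "compat n (base n w) (num_rows n w) (flag n w) (w \<circ> flag n w) w"
  unfolding compat_def
proof (intro conjI ballI)
  fix r assume r: "r \<in> {1..num_rows n w}"
  have "flag n w r \<in> {1..n}" "flag n w r < w (flag n w r)"
    using flag_mem[OF r] by (auto simp: excedances_def)
  moreover have "w (flag n w r) \<in> {1..n}"
    using calculation permutes_in_image[OF w] by blast
  ultimately show "1 \<le> flag n w r" "flag n w r \<le> (w \<circ> flag n w) r" "(w \<circ> flag n w) r \<le> n"
    by auto
  show "(w \<circ> flag n w) r \<le> base n w + r"
    using shape_base(2)[OF r] by simp
  show "w (flag n w r) = (w \<circ> flag n w) r" by simp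
next
  show f: "strict_mono_on {1..num_rows n w} (flag n w)"
    by (auto intro!: strict_mono_onI flag_less)
  then show "strict_mono_on {1..num_rows n w} (w \<circ> flag n w)"
    by (auto intro!: strict_mono_onI excedance_values_less[OF w avoid] flag_mem flag_less)
  show "strict_mono_on ({1..n} - flag n w ` {1..num_rows n w}) w"
    unfolding flag_image
    by (intro strict_mono_onI nonexcedance_values_less[OF w avoid])
qed (rule w)

lemma SVT_finite_nonempty:
  assumes "T \<in> SVT D f" "(r, c) \<in> D"
  shows "T (r, c) \<noteq> {}" "T (r, c) \<subseteq> {1..f r}" "finite (T (r, c))"
proof -
  have "T \<in> (\<Pi>\<^sub>E (i, j) \<in> D. {A. A \<noteq> {} \<and> A \<subseteq> {1..f i}})"
    using assms(1) by (simp add: SVT_def)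
  from PiE_mem[OF this assms(2)] show "T (r, c) \<noteq> {}" "T (r, c) \<subseteq> {1..f r}" by auto
  then show "finite (T (r, c))" by (meson finite_atLeastAtMost finite_subset)
qed

text \<open>In row r the contents lie between f(r) and w(f(r)) - 1 < n, so the flag bound implies
  the staircase bound. The converse comes from the last box of the row.\<close>

lemma SVT_eq_tableaux:
  "SVT (sigma_shape n w) (flag n w)
     = tableaux (sigma_shape n w) (allowed (base n w) (set (cells n)))"
proof (intro equalityI subsetI)
  let ?D = "sigma_shape n w" and ?A = "allowed (base n w) (set (cells n))"
  let ?f = "flag n w" and ?K = "base n w" and ?R = "num_rows n w"
  have D: "1 \<le> r \<and> r \<le> ?R \<and> c + ?f r \<le> ?K + r \<and> ?K + r < w (?f r) + c \<and> w (?f r) \<le> n"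
    if "(r, c) \<in> ?D" for r c
    using that compat_permutation unfolding sigma_shape_eq_region
    by (auto simp: region_def compat_def)
  {
    fix T assume T: "T \<in> SVT ?D ?f"
    note fin = SVT_finite_nonempty[OF T]
    have T': "T \<in> (\<Pi>\<^sub>E (i, j) \<in> ?D. {A. A \<noteq> {} \<and> A \<subseteq> {1..?f i}})"
      and rows: "\<And>i j j'. (i, j) \<in> ?D \<Longrightarrow> (i, j') \<in> ?D \<Longrightarrow> j < j' \<Longrightarrow> Max (T (i, j)) \<le> Min (T (i, j'))"
      and cols: "\<And>i i' j. (i, j) \<in> ?D \<Longrightarrow> (i', j) \<in> ?D \<Longrightarrow> i < i' \<Longrightarrow> Max (T (i, j)) < Min (T (i', j))"
      using T by (auto simp: SVT_def)
    show "T \<in> tableaux ?D ?A"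
    proof (rule tableauxI)
      fix q assume "q \<in> ?D"
      then show "T q \<noteq> {}" using fin(1) by (cases q) auto
    next
      fix q v assume q: "q \<in> ?D" "v \<in> T q"
      obtain r c where rc: "q = (r, c)" by fastforce
      have "1 \<le> v" "v \<le> ?f r" using fin(2)[of r c] q rc by auto
      then show "v \<in> ?A q"
        using D[of r c] q rc by (auto simp: allowed_def set_cells content_def)
    next
      fix q assume "q \<notin> ?D"
      then show "T q = undefined" by (rule PiE_arb[OF T'])
    next
      fix i j j' a b
      assume *: "(i, j) \<in> ?D" "(i, j') \<in> ?D" "j < j'" "a \<in> T (i, j)" "b \<in> T (i, j')"
      have "a \<le> Max (T (i, j))" using * fin by simp
      also have "\<dots> \<le> Min (T (i, j'))" using * rows by simp
      also have "\<dots> \<le> b" using * fin by simp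
      finally show "a \<le> b" .
    next
      fix i i' j a b
      assume *: "(i, j) \<in> ?D" "(i', j) \<in> ?D" "i < i'" "a \<in> T (i, j)" "b \<in> T (i', j)"
      have "a \<le> Max (T (i, j))" using * fin by simp
      also have "\<dots> < Min (T (i', j))" using * cols by simp
      also have "\<dots> \<le> b" using * fin by simp
      finally show "a < b" .
    qed
  next
    fix T assume T: "T \<in> tableaux ?D ?A"
    \<comment> \<open>The last box of row \<open>r\<close> has content \<open>f r\<close>, which bounds its entries and so the whole row.\<close>
    have bounds: "1 \<le> v \<and> v \<le> ?f r" if "(r, c) \<in> ?D" "v \<in> T (r, c)" for r c v
    proof -
      let ?l = "?K + r - ?f r"
      have last: "(r, ?l) \<in> ?D"
        using D[OF that(1)] flag_mem[of r n w]
        unfolding sigma_shape_eq_region by (auto simp: region_def excedances_def)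
      have le_flag: "b \<le> ?f r" if "b \<in> T (r, ?l)" for b
        using tableauxD(2)[OF T last that] D[OF last]
        by (auto simp: allowed_def set_cells content_def)
      obtain b where b: "b \<in> T (r, ?l)" using tableauxD(1)[OF T last] by blast
      have "c \<le> ?l" using D[OF that(1)] by auto
      then have "v \<le> ?f r"
        using le_flag b that tableauxD(4)[OF T that(1) last _ that(2) b] by (cases "c = ?l") force+
      moreover have "1 \<le> v"
        using tableauxD(2)[OF T that] by (auto simp: allowed_def set_cells)
      ultimately show ?thesis by simp
    qed
    have fin: "finite (T q) \<and> T q \<noteq> {}" if "q \<in> ?D" for q
      using tableauxD(1,2)[OF T that] finite_allowed[of "set (cells n)" ?K q]
      by (meson finite_set rev_finite_subset subsetI)
    show "T \<in> SVT ?D ?f"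
      unfolding SVT_def
    proof (intro CollectI conjI PiE_I allI impI)
      fix q assume "q \<in> ?D"
      then show "T q \<in> (case q of (i, j) \<Rightarrow> {A. A \<noteq> {} \<and> A \<subseteq> {1..?f i}})"
        using fin bounds by (cases q) fastforce
    next
      fix q assume "q \<notin> ?D"
      then show "T q = undefined" by (rule tableauxD(3)[OF T])
    next
      fix i j j' assume *: "(i, j) \<in> ?D \<and> (i, j') \<in> ?D \<and> j < j'"
      then have "Max (T (i, j)) \<in> T (i, j)" "Min (T (i, j')) \<in> T (i, j')"
        using fin by auto
      then show "Max (T (i, j)) \<le> Min (T (i, j'))"
        using tableauxD(4)[OF T] * by blast
    next
      fix i i' j assume *: "(i, j) \<in> ?D \<and> (i', j) \<in> ?D \<and> i < i'"
      then have "Max (T (i, j)) \<in> T (i, j)" "Min (T (i', j)) \<in> T (i', j)"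
        using fin by auto
      then show "Max (T (i, j)) < Min (T (i', j))"
        using tableauxD(5)[OF T] * by blast
    qed
  }
qed

lemma tableau_weight_eq:
  assumes T: "T \<in> SVT (sigma_shape n w) (flag n w)"
  shows "(\<Prod>q \<in> sigma_shape n w. box_weight (base n w) q (T q))
     = \<beta> ^ (card (entries (sigma_shape n w) T) - card (sigma_shape n w)) *
       (\<Prod>((r, c), v) \<in> entries (sigma_shape n w) T.
          xvar v \<oplus> bvar (outer_shape n w r + flag n w r - c - v + 1))"
proof -
  let ?D = "sigma_shape n w"
  have finD: "finite ?D" by (simp add: sigma_shape_eq_region)
  have fin: "finite (T q)" "T q \<noteq> {}" if "q \<in> ?D" for q
    using SVT_finite_nonempty[OF T, of "fst q" "snd q"] that by auto
  then have "card (entries ?D T) = (\<Sum>q \<in> ?D. card (T q))"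
    using finD unfolding entries_def by (intro card_SigmaI) auto
  \<comment> \<open>The sets are nonempty, so no difference truncates.\<close>
  then have card: "card (entries ?D T) - card ?D = (\<Sum>q \<in> ?D. card (T q) - 1)"
    using fin by (subst sum_subtractf_nat) (auto simp: card_gt_0_iff Suc_le_eq)
  have "cell_weight v (content (base n w) (r, c))
      = xvar v \<oplus> bvar (outer_shape n w r + flag n w r - c - v + 1)"
    if "(r, c) \<in> ?D" "v \<in> T (r, c)" for r c v
  proof -
    have "outer_shape n w r + flag n w r = base n w + r"
      using that(1) by (intro shape_base) (auto simp: sigma_shape_def boxes_def)
    \<comment> \<open>This makes content - v + 1 and content + 1 - v agree as natural
      numbers.\<close>
    moreover have "v \<le> base n w + r - c"
      using tableauxD(2)[OF T[unfolded SVT_eq_tableaux] that]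
      by (auto simp: allowed_def set_cells content_def)
    ultimately show ?thesis by (simp add: cell_weight_def content_def Suc_diff_le)
  qed
  then have "(\<Prod>q \<in> ?D. \<Prod>v \<in> T q. cell_weight v (content (base n w) q))
     = (\<Prod>q \<in> ?D. \<Prod>v \<in> T q. xvar v \<oplus>
          bvar (outer_shape n w (fst q) + flag n w (fst q) - snd q - v + 1))"
    by (intro prod.cong refl) auto
  also have "\<dots> = (\<Prod>((r, c), v) \<in> entries ?D T.
          xvar v \<oplus> bvar (outer_shape n w r + flag n w r - c - v + 1))"
    unfolding entries_def using finD fin
    by (subst prod.Sigma) (auto intro!: prod.cong)
  finally show ?thesis
    by (simp add: box_weight_def prod.distrib card power_sum)
qed

end

theorem theorem3p1:
  fixes n :: nat and w :: "nat \<Rightarrow> nat"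
  assumes "n \<ge> 1" and "w permutes {1..n}" and "avoids_321 n w"
  shows "grothendieck n w =
    (\<Sum>T \<in> SVT (sigma_shape n w) (flag n w).
       \<beta> ^ (card (entries (sigma_shape n w) T) - card (sigma_shape n w)) *
       (\<Prod>((r, c), v) \<in> entries (sigma_shape n w) T.
          xvar v \<oplus> bvar (outer_shape n w r + flag n w r - c - v + 1)))"
proof -
  let ?D = "sigma_shape n w"
  have "snd ` set (cells n) \<subseteq> {1..<n}" by (auto simp: set_cells)
  from act_eq_tableaux_sum[OF sorted_wrt_cells this compat_permutation[OF assms(2,3)]]
  have "grothendieck n w = (\<Sum>T \<in> tableaux ?D (allowed (base n w) (set (cells n))).
      \<Prod>q \<in> ?D. box_weight (base n w) q (T q))"
    unfolding grothendieck_eq_coeff_family[OF assms(2)] coeff_family_def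
      sigma_shape_eq_region[OF assms(2,3), symmetric] .
  also have "\<dots> = (\<Sum>T \<in> SVT ?D (flag n w). \<Prod>q \<in> ?D. box_weight (base n w) q (T q))"
    by (simp add: SVT_eq_tableaux[OF assms(2,3)])
  finally show ?thesis
    by (simp add: tableau_weight_eq[OF assms(2,3)])
qed

end
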